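(* Let $N_r\ge N_t\ge 2$, let $\mathbf{H}\in\mathbb{C}^{N_r\times N_t}$, let $E_s,N_0>0$, and fix $1\le\nu\le N_t-1$. Assume $\mathbf{x}\sim\mathcal{CN}(\mathbf{0},E_s\mathbf{I}_{N_t})$ with density $p(\mathbf{x})$, and let $\mathbf{y}=\mathbf{H}\mathbf{x}+\mathbf{z}$ with $\mathbf{z}\sim\mathcal{CN}(\mathbf{0},N_0\mathbf{I}_{N_r})$ independent of $\mathbf{x}$. For $\mathbf{F}\in\mathbb{C}^{N_r\times N_t}$ and a Hermitian positive semidefinite $\mathbf{G}\in\mathbb{C}^{N_t\times N_t}$, define $$p_{\mathrm m}(\mathbf{y}|\mathbf{x})=\exp\big(2\,\mathrm{Re}\{\mathbf{y}^\dagger\mathbf{F}\mathbf{x}\}-\mathbf{x}^\dagger\mathbf{G}\mathbf{x}+\tfrac{1}{E_s}\mathbf{x}^\dagger\mathbf{x}\big),\qquad p_{\mathrm m}(\mathbf{y})=\int p_{\mathrm m}(\mathbf{y}|\mathbf{x})p(\mathbf{x})\,d\mathbf{x},$$ and $$I_{\mathrm{LB}}(\mathbf{F},\mathbf{G})=\mathbb{E}_{\mathbf{Y},\mathbf{X}}[\log p_{\mathrm m}(\mathbf{y}|\mathbf{x})]-\mathbb{E}_{\mathbf{Y}}[\log p_{\mathrm m}(\mathbf{y})],$$ with expectations taken over the true joint distribution of $(\mathbf{x},\mathbf{y})$. Consider the maximization of $I_{\mathrm{LB}}$ over $\mathbf{F}$ and over $\mathbf{G}=\mathbf{J}^\dagger\mathbf{J}$,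 where $\mathbf{J}$ has a punctured structure of order $\nu$, i.e. $$\mathbf{J}=\begin{bmatrix}\mathbf{J}_1&\mathbf{0}\\ \mathbf{J}_2&\mathbf{J}_3\end{bmatrix}$$ with $\mathbf{J}_1\in\mathbb{C}^{\nu\times\nu}$ lower triangular, $\mathbf{J}_2\in\mathbb{C}^{(N_t-\nu)\times\nu}$ arbitrary, and $\mathbf{J}_3\in\mathbb{R}^{(N_t-\nu)\times(N_t-\nu)}$ real diagonal. Then the optimal $\mathbf{F}$ and $\mathbf{G}$ are $$\mathbf{F}^{\mathrm{opt}}=\mathbf{W}_{\mathrm{MMSE}}^\dagger\mathbf{G}^{\mathrm{opt}},\qquad \mathbf{G}^{\mathrm{opt}}=\mathbf{J}^{\mathrm{opt}\dagger}\mathbf{J}^{\mathrm{opt}},\qquad \mathbf{J}^{\mathrm{opt}}=\mathbf{L}_{\mathrm{ap}},$$ where $\mathbf{W}_{\mathrm{MMSE}}$ and $\mathbf{L}_{\mathrm{ap}}$ are defined in the context. Consequently, the value $N_t\log E_s+\log\det(\mathbf{L}_{\mathrm{ap}}^\dagger\mathbf{L}_{\mathrm{ap}})$, attained by the augmented WLD detector (the choice $\mathbf{F}=\mathbf{W}_{\mathrm{MMSE}}^\dagger\mathbf{L}_{\mathrm{ap}}^\dagger\mathbf{L}_{\mathrm{ap}}$, $\mathbf{G}=\mathbf{L}_{\mathrm{ap}}^\dagger\mathbf{L}_{\mathrm{ap}}$), is the optimal value of $I_{\mathrm{LB}}$ over this class.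
   Context: Let $\alpha=N_0/E_s$, and let $\mathbf{W}_{\mathrm{MMSE}}=(\mathbf{H}^\dagger\mathbf{H}+\alpha\mathbf{I}_{N_t})^{-1}\mathbf{H}^\dagger$ be the standard MMSE filter. Form the augmented matrix $$\mathbf{H}_{\mathrm a}=\begin{bmatrix}\tfrac{1}{\sqrt{N_0}}\mathbf{H}\\ \tfrac{1}{\sqrt{E_s}}\mathbf{I}_{N_t}\end{bmatrix}$$ and let $\mathbf{H}_{\mathrm a}=\mathbf{Q}_{\mathrm a}\mathbf{L}_{\mathrm a}$ be its thin QL decomposition: $\mathbf{Q}_{\mathrm a}$ has orthonormal columns and $\mathbf{L}_{\mathrm a}$ is $N_t\times N_t$ lower triangular with real positive diagonal entries. Partition $$\mathbf{L}_{\mathrm a}=\begin{bmatrix}\mathbf{P}_{\mathrm a}&\mathbf{0}\\ \mathbf{R}_{\mathrm a}&\mathbf{S}_{\mathrm a}\end{bmatrix},$$ with $\mathbf{P}_{\mathrm a}$ of size $\nu\times\nu$ and $\mathbf{S}_{\mathrm a}$ of size $(N_t-\nu)\times(N_t-\nu)$. Define $$\boldsymbol{\Sigma}_{\mathrm a}=\operatorname{diag}(\mathbf{S}_{\mathrm a}^{-1}\mathbf{S}_{\mathrm a}^{-\dagger})^{-1/2},\qquad \mathbf{W}_{\mathrm{ap}}=\begin{bmatrix}\mathbf{I}_\nu&\mathbf{0}\\ \mathbf{0}&\boldsymbol{\Sigma}_{\mathrm a}\mathbf{S}_{\mathrm a}^{-1}\end{bmatrix},\qquad \mathbf{L}_{\mathrm{ap}}=\mathbf{W}_{\mathrm{ap}}\mathbf{L}_{\mathrm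 a}.$$ Here $\operatorname{diag}(\mathbf{A})$ denotes the diagonal matrix having the same diagonal entries as $\mathbf{A}$, the superscript $\dagger$ denotes conjugate transpose, and $\log$ is the natural logarithm. *)

theory Defs
  imports "HOL-Probability.Probability" "Jordan_Normal_Form.Determinant"
begin

definition adjC :: "complex mat \<Rightarrow> complex mat" where
  "adjC A = mat (dim_col A) (dim_row A) (\<lambda>(i,j). cnj (A $$ (j,i)))"

text \<open>Inverse of a square matrix (Cramer's rule; used only for invertible matrices).\<close>
definition invC :: "complex mat \<Rightarrow> complex mat" where
  "invC A = (1 / det A) \<cdot>\<^sub>m adj_mat A"

definition lower_tri :: "complex mat \<Rightarrow> bool" where
  "lower_tri A \<longleftrightarrow> (\<forall>i<dim_row A. \<forall>j<dim_col A. i < j \<longrightarrow> A $$ (i,j) = 0)"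

definition blk :: "complex mat \<Rightarrow> nat \<Rightarrow> nat \<Rightarrow> nat \<Rightarrow> nat \<Rightarrow> complex mat" where
  "blk A r0 c0 nr nc = mat nr nc (\<lambda>(i,j). A $$ (i + r0, j + c0))"

definition diag_part :: "complex mat \<Rightarrow> complex mat" where
  "diag_part A = mat (dim_row A) (dim_col A) (\<lambda>(i,j). if i = j then A $$ (i,i) else 0)"

text \<open>diag(A)^(-1/2) for a matrix whose diagonal entries are positive reals.\<close>
definition diag_inv_sqrt :: "complex mat \<Rightarrow> complex mat" where
  "diag_inv_sqrt A = mat (dim_row A) (dim_col A)
     (\<lambda>(i,j). if i = j then complex_of_real (1 / sqrt (Re (A $$ (i,i)))) else 0)"

definition punctured :: "nat \<Rightarrow> nat \<Rightarrow> complex mat \<Rightarrow> bool" where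
  "punctured nu Nt J \<longleftrightarrow> (\<exists>J1 J2 J3.
      J1 \<in> carrier_mat nu nu \<and> lower_tri J1 \<and>
      J2 \<in> carrier_mat (Nt - nu) nu \<and>
      J3 \<in> carrier_mat (Nt - nu) (Nt - nu) \<and> diagonal_mat J3 \<and>
      (\<forall>i < Nt - nu. J3 $$ (i,i) \<in> \<real>) \<and>
      J = four_block_mat J1 (0\<^sub>m nu (Nt - nu)) J2 J3)"

definition W_MMSE :: "complex mat \<Rightarrow> real \<Rightarrow> real \<Rightarrow> complex mat" where
  "W_MMSE H Es N0 = invC (adjC H * H + complex_of_real (N0 / Es) \<cdot>\<^sub>m 1\<^sub>m (dim_col H)) * adjC H"

definition H_aug :: "complex mat \<Rightarrow> real \<Rightarrow> real \<Rightarrow> complex mat" where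
  "H_aug H Es N0 = four_block_mat
      (complex_of_real (1 / sqrt N0) \<cdot>\<^sub>m H) (0\<^sub>m (dim_row H) 0)
      (complex_of_real (1 / sqrt Es) \<cdot>\<^sub>m 1\<^sub>m (dim_col H)) (0\<^sub>m (dim_col H) 0)"

definition is_thin_QL :: "complex mat \<Rightarrow> complex mat \<Rightarrow> complex mat \<Rightarrow> bool" where
  "is_thin_QL A Q L \<longleftrightarrow>
     Q \<in> carrier_mat (dim_row A) (dim_col A) \<and> L \<in> carrier_mat (dim_col A) (dim_col A) \<and>
     adjC Q * Q = 1\<^sub>m (dim_col A) \<and> lower_tri L \<and>
     (\<forall>i < dim_col A. L $$ (i,i) \<in> \<real> \<and> Re (L $$ (i,i)) > 0) \<and>
     A = Q * L"

definition L_ap :: "nat \<Rightarrow> complex mat \<Rightarrow> complex mat" where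
  "L_ap nu La = (let Nt = dim_col La;
                    S = blk La nu nu (Nt - nu) (Nt - nu);
                    Sigma = diag_inv_sqrt (diag_part (invC S * adjC (invC S)));
                    Wap = four_block_mat (1\<^sub>m nu) (0\<^sub>m nu (Nt - nu))
                                         (0\<^sub>m (Nt - nu) nu) (Sigma * invC S)
                 in Wap * La)"

definition lebC :: "nat \<Rightarrow> (nat \<Rightarrow> complex) measure" where
  "lebC n = PiM {..<n} (\<lambda>_. (lborel :: complex measure))"

definition cgauss_dens :: "nat \<Rightarrow> real \<Rightarrow> (nat \<Rightarrow> complex) \<Rightarrow> real" where
  "cgauss_dens n s x = (\<Prod>i<n. exp (- (cmod (x i))\<^sup>2 / s) / (pi * s))"

definition cgauss :: "nat \<Rightarrow> real \<Rightarrow> (nat \<Rightarrow> complex) measure" where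
  "cgauss n s = density (lebC n) (\<lambda>x. ennreal (cgauss_dens n s x))"

definition joint_xz :: "nat \<Rightarrow> nat \<Rightarrow> real \<Rightarrow> real \<Rightarrow> ((nat \<Rightarrow> complex) \<times> (nat \<Rightarrow> complex)) measure" where
  "joint_xz Nr Nt Es N0 = cgauss Nt Es \<Otimes>\<^sub>M cgauss Nr N0"

definition rx :: "complex mat \<Rightarrow> (nat \<Rightarrow> complex) \<Rightarrow> (nat \<Rightarrow> complex) \<Rightarrow> complex vec" where
  "rx H x z = H *\<^sub>v vec (dim_col H) x + vec (dim_row H) z"

definition pm_cond :: "complex mat \<Rightarrow> complex mat \<Rightarrow> real \<Rightarrow> complex vec \<Rightarrow> complex vec \<Rightarrow> real" where
  "pm_cond F G Es y x = exp (2 * Re (map_vec cnj y \<bullet> (F *\<^sub>v x))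
                            - Re (map_vec cnj x \<bullet> (G *\<^sub>v x))
                            + Re (map_vec cnj x \<bullet> x) / Es)"

definition pm_marg :: "nat \<Rightarrow> complex mat \<Rightarrow> complex mat \<Rightarrow> real \<Rightarrow> complex vec \<Rightarrow> real" where
  "pm_marg Nt F G Es y = (\<integral>x. pm_cond F G Es y (vec Nt x) * cgauss_dens Nt Es x \<partial>lebC Nt)"

definition I_LB :: "complex mat \<Rightarrow> real \<Rightarrow> real \<Rightarrow> complex mat \<Rightarrow> complex mat \<Rightarrow> real" where
  "I_LB H Es N0 F G =
     (\<integral>xz. ln (pm_cond F G Es (rx H (fst xz) (snd xz)) (vec (dim_col H) (fst xz)))
        \<partial>joint_xz (dim_row H) (dim_col H) Es N0)
   - (\<integral>xz. ln (pm_marg (dim_col H) F G Es (rx H (fst xz) (snd xz)))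
        \<partial>joint_xz (dim_row H) (dim_col H) Es N0)"

definition I_LB_defined :: "complex mat \<Rightarrow> real \<Rightarrow> real \<Rightarrow> complex mat \<Rightarrow> complex mat \<Rightarrow> bool" where
  "I_LB_defined H Es N0 F G \<longleftrightarrow>
     (\<forall>y. dim_vec y = dim_row H \<longrightarrow>
        integrable (lebC (dim_col H))
          (\<lambda>x. pm_cond F G Es y (vec (dim_col H) x) * cgauss_dens (dim_col H) Es x)) \<and>
     integrable (joint_xz (dim_row H) (dim_col H) Es N0)
       (\<lambda>xz. ln (pm_cond F G Es (rx H (fst xz) (snd xz)) (vec (dim_col H) (fst xz)))) \<and>
     integrable (joint_xz (dim_row H) (dim_col H) Es N0)
       (\<lambda>xz. ln (pm_marg (dim_col H) F G Es (rx H (fst xz) (snd xz))))"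

end

theory Submission
  imports Defs
begin

text \<open>For lower triangular \<open>J\<close> with nonzero diagonal put \<open>C = J\<^sup>-\<^sup>\<dagger> F\<^sup>\<dagger>\<close>. Completing the square gives
  \<open>ln p\<^sub>m(y|x) = |x|\<^sup>2 / E\<^sub>s + |C y|\<^sup>2 - |J x - C y|\<^sup>2\<close>, and the term \<open>|C y|\<^sup>2\<close> cancels against the
  one in \<open>ln p\<^sub>m(y)\<close>, so that \<open>I\<^sub>L\<^sub>B\<close> equals
  \<open>N\<^sub>t + N\<^sub>t ln E\<^sub>s + \<Sum>\<^sub>i ln |J\<^sub>i\<^sub>i|\<^sup>2 - E\<^sub>s \<parallel>J - C H\<parallel>\<^sup>2 - N\<^sub>0 \<parallel>C\<parallel>\<^sup>2\<close> in the Frobenius norm.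
  The last two terms are \<open>-\<parallel>U\<parallel>\<^sup>2\<close> for \<open>U = [\<surd>N\<^sub>0 C, \<surd>E\<^sub>s (J - C H)]\<close>, which satisfies \<open>U H\<^sub>a = J\<close>.
  Hence \<open>T = U Q\<^sub>a\<close> satisfies \<open>T L\<^sub>a = J\<close> and \<open>\<parallel>T\<parallel> \<le> \<parallel>U\<parallel>\<close> (Bessel), with equality for the MMSE filter.
  The punctured structure bounds the norm of row \<open>i\<close> of \<open>T\<close> below by \<open>|J\<^sub>i\<^sub>i| / |(L\<^sub>a\<^sub>p)\<^sub>i\<^sub>i|\<close>, and
  \<open>ln t \<le> t - 1\<close> finishes the proof. If some \<open>J\<^sub>i\<^sub>i\<close> vanishes, \<open>p\<^sub>m(y)\<close> is infinite.\<close>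

subsection \<open>Gaussian integrals\<close>

text \<open>Both integrands are \<open>sqrt (pi * s)\<close> times an even moment of the centred
  normal density with variance \<open>s / 2\<close>, the variance of each real coordinate of a
  complex Gaussian of variance \<open>s\<close>.\<close>

lemma nn_integral_gauss_real:
  assumes "s > 0"
  shows "(\<integral>\<^sup>+x. ennreal (exp (- (x\<^sup>2 / s))) \<partial>lborel) = ennreal (sqrt (pi * s))"
    and "(\<integral>\<^sup>+x. ennreal (x\<^sup>2 * exp (- (x\<^sup>2 / s))) \<partial>lborel) = ennreal (sqrt (pi * s) * s / 2)"
proof -
  define \<sigma> where "\<sigma> = sqrt (s / 2)"
  have \<sigma>: "\<sigma> > 0" "\<sigma>\<^sup>2 = s / 2"
    using assms by (auto simp: \<sigma>_def)
  have nd: "exp (- (x\<^sup>2 / s)) = sqrt (pi * s) * normal_density 0 \<sigma> x" for x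
    using assms by (simp add: normal_density_def \<sigma>)
  have nd2: "x\<^sup>2 * exp (- (x\<^sup>2 / s)) = sqrt (pi * s) * (normal_density 0 \<sigma> x * (x - 0) ^ (2 * 1))" for x
    by (simp only: nd) simp
  have 0: "has_bochner_integral lborel (\<lambda>x. sqrt (pi * s) * normal_density 0 \<sigma> x) (sqrt (pi * s))"
    using has_bochner_integral_mult_right[OF normal_moment_even[OF \<sigma>(1), of 0 0], of "sqrt (pi * s)"]
    by simp
  have 1: "has_bochner_integral lborel (\<lambda>x. sqrt (pi * s) * (normal_density 0 \<sigma> x * (x - 0) ^ (2 * 1))) (sqrt (pi * s) * s / 2)"
    using has_bochner_integral_mult_right[OF normal_moment_even[OF \<sigma>(1), of 0 1], of "sqrt (pi * s)"] assms
    by (simp add: \<sigma>)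
  show "(\<integral>\<^sup>+x. ennreal (exp (- (x\<^sup>2 / s))) \<partial>lborel) = ennreal (sqrt (pi * s))"
    unfolding nd using assms 0
    by (subst nn_integral_eq_integral) (auto simp: has_bochner_integral_iff)
  show "(\<integral>\<^sup>+x. ennreal (x\<^sup>2 * exp (- (x\<^sup>2 / s))) \<partial>lborel) = ennreal (sqrt (pi * s) * s / 2)"
    unfolding nd2 using assms 1
    by (subst nn_integral_eq_integral) (auto simp: has_bochner_integral_iff)
qed

text \<open>Fubini in Cartesian coordinates. The factors are indexed by the basis elements, 1 and
  the imaginary unit; that these differ is what splits the product into exactly two factors.\<close>

lemma nn_integral_complex_prod:
  assumes [measurable]: "f \<in> borel_measurable borel" "g \<in> borel_measurable borel"
  shows "(\<integral>\<^sup>+z. f (Re z) * g (Im z) \<partial>lborel) = (\<integral>\<^sup>+x. f x \<partial>lborel) * (\<integral>\<^sup>+y. (g y :: ennreal) \<partial>lborel)"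
proof -
  have "\<i> \<noteq> 1" by (simp add: complex_eq_iff)
  moreover have "(\<integral>\<^sup>+(z::complex). (\<Prod>b\<in>Basis. (if b = 1 then f else g) (z \<bullet> b)) \<partial>lborel)
      = (\<Prod>b\<in>(Basis :: complex set). \<integral>\<^sup>+x. (if b = 1 then f else g) x \<partial>lborel)"
    by (rule nn_integral_lborel_prod[of "\<lambda>b. if b = 1 then f else g"]) auto
  ultimately show ?thesis
    by (simp add: Basis_complex_def inner_complex_def)
qed

lemma nn_integral_lborel_affine:
  fixes t :: "'a::euclidean_space"
  assumes [measurable]: "f \<in> borel_measurable borel" and "c \<noteq> 0"
  shows "(\<integral>\<^sup>+z. f z \<partial>lborel) = ennreal (\<bar>c\<bar> ^ DIM('a)) * (\<integral>\<^sup>+z. f (t + c *\<^sub>R z) \<partial>lborel)"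
  by (subst lborel_affine[OF assms(2), of t])
     (simp add: nn_integral_density nn_integral_distr nn_integral_cmult)

text \<open>The squared modulus is the sum of the squares of the two coordinates, so the exponential
  factorises and the second moment becomes two products of a real second moment and a real total
  mass, each contributing half of the value.\<close>

lemma nn_integral_gauss_complex:
  assumes "s > 0"
  shows "(\<integral>\<^sup>+z. ennreal (exp (- ((cmod z)\<^sup>2 / s))) \<partial>lborel) = ennreal (pi * s)"
    and "(\<integral>\<^sup>+z. ennreal ((cmod z)\<^sup>2 * exp (- ((cmod z)\<^sup>2 / s))) \<partial>lborel) = ennreal (pi * s * s)"
proof -
  let ?e = "\<lambda>x. exp (- (x\<^sup>2 / s))"
  have e: "exp (- ((cmod z)\<^sup>2 / s)) = ?e (Re z) * ?e (Im z)" for z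
    by (simp add: mult_exp_exp cmod_power2 add_divide_distrib)
  have "(\<integral>\<^sup>+z. ennreal (exp (- ((cmod z)\<^sup>2 / s))) \<partial>lborel)
    = (\<integral>\<^sup>+z. ennreal (?e (Re z)) * ennreal (?e (Im z)) \<partial>lborel)"
    by (simp add: e ennreal_mult)
  also have "\<dots> = ennreal (pi * s)"
    using assms by (subst nn_integral_complex_prod) (simp_all add: nn_integral_gauss_real flip: ennreal_mult)
  finally show "(\<integral>\<^sup>+z. ennreal (exp (- ((cmod z)\<^sup>2 / s))) \<partial>lborel) = ennreal (pi * s)" .
  have "(\<integral>\<^sup>+z. ennreal ((cmod z)\<^sup>2 * exp (- ((cmod z)\<^sup>2 / s))) \<partial>lborel)
    = (\<integral>\<^sup>+z. ennreal ((Re z)\<^sup>2 * ?e (Re z)) * ennreal (?e (Im z))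
        + ennreal (?e (Re z)) * ennreal ((Im z)\<^sup>2 * ?e (Im z)) \<partial>lborel)"
    unfolding e unfolding cmod_power2
    by (intro nn_integral_cong) (simp add: algebra_simps flip: ennreal_mult ennreal_plus)
  also have "\<dots> = ennreal (sqrt (pi * s) * s / 2) * ennreal (sqrt (pi * s))
      + ennreal (sqrt (pi * s)) * ennreal (sqrt (pi * s) * s / 2)"
    using assms
    by (subst nn_integral_add; (subst nn_integral_complex_prod)?; (subst nn_integral_complex_prod)?)
       (simp_all add: nn_integral_gauss_real)
  also have "\<dots> = ennreal (pi * s * s)"
    using assms by (simp add: algebra_simps flip: ennreal_mult ennreal_plus)
  finally show "(\<integral>\<^sup>+z. ennreal ((cmod z)\<^sup>2 * exp (- ((cmod z)\<^sup>2 / s))) \<partial>lborel) = ennreal (pi * s * s)" .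
qed

text \<open>For \<open>a\<close> nonzero, the shift by \<open>- w / a\<close> and the real scaling
  by \<open>1 / cmod a\<close> leave the modulus of \<open>z\<close> alone, since the phase of
  \<open>a\<close> does not affect it. The plane has real dimension two, hence the square in the
  Jacobian. For \<open>a = 0\<close> the integrand is a positive constant on a space of infinite
  measure.\<close>

lemma nn_integral_gauss_complex_affine:
  fixes a w :: complex
  shows "(\<integral>\<^sup>+z. ennreal (exp (- (cmod (a * z + w))\<^sup>2)) \<partial>lborel)
    = (if a = 0 then \<infinity> else ennreal (pi / (cmod a)\<^sup>2))"
proof (cases "a = 0")
  case True
  then show ?thesis
    by (simp add: emeasure_lborel_UNIV ennreal_mult_eq_top_iff)
next
  case False
  have eq: "cmod (a * (- w / a + (1 / cmod a) *\<^sub>R z) + w) = cmod z" for z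
    using False by (simp add: norm_mult norm_divide algebra_simps)
  have "(\<integral>\<^sup>+z. ennreal (exp (- (cmod (a * z + w))\<^sup>2)) \<partial>lborel) = ennreal (\<bar>1 / cmod a\<bar> ^ DIM(complex)) *
      (\<integral>\<^sup>+z. ennreal (exp (- (cmod (a * (- w / a + (1 / cmod a) *\<^sub>R z) + w))\<^sup>2)) \<partial>lborel)"
    by (rule nn_integral_lborel_affine) (use False in auto)
  then show ?thesis
    unfolding eq using False nn_integral_gauss_complex(1)[of 1]
    by (simp add: power_divide flip: ennreal_mult)
qed

text \<open>The cross term between \<open>a * z\<close> and \<open>w\<close> is odd in
  \<open>z\<close>. Adding the integral to its reflection and applying the parallelogram law
  \<open>par\<close> removes that term without any subtraction, which \<open>ennreal\<close> would
  not handle well.\<close>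

lemma nn_integral_sq_gauss_complex_affine:
  assumes "s > 0"
  shows "(\<integral>\<^sup>+z. ennreal ((cmod (a * z + w))\<^sup>2) * ennreal (exp (- ((cmod z)\<^sup>2 / s)) / (pi * s)) \<partial>lborel)
    = ennreal ((cmod a)\<^sup>2 * s + (cmod w)\<^sup>2)"
proof -
  let ?e = "\<lambda>z. exp (- ((cmod z)\<^sup>2 / s)) / (pi * s)"
  define I where "I = (\<integral>\<^sup>+z. ennreal ((cmod (a * z + w))\<^sup>2) * ennreal (?e z) \<partial>lborel)"
  have par: "(cmod (a * z + w))\<^sup>2 + (cmod (- (a * z) + w))\<^sup>2 = 2 * ((cmod a)\<^sup>2 * (cmod z)\<^sup>2 + (cmod w)\<^sup>2)" for z
  proof -
    have "(cmod (u + w))\<^sup>2 + (cmod (- u + w))\<^sup>2 = 2 * ((cmod u)\<^sup>2 + (cmod w)\<^sup>2)" for u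
      unfolding cmod_power2 by (simp add: power2_eq_square algebra_simps)
    from this[of "a * z"] show ?thesis
      by (simp only: norm_mult power_mult_distrib)
  qed
  have gen: "ennreal p * ennreal e + ennreal q * ennreal f = ennreal (p * e + q * f)"
    if "0 \<le> p" "0 \<le> q" "0 \<le> e" "0 \<le> f" for p q e f
    using that by (simp add: ennreal_mult)
  have sum_eq: "ennreal ((cmod (a * z + w))\<^sup>2) * ennreal (?e z) + ennreal ((cmod (- (a * z) + w))\<^sup>2) * ennreal (?e z)
      = ennreal (2 * (cmod a)\<^sup>2 / (pi * s)) * ennreal ((cmod z)\<^sup>2 * exp (- ((cmod z)\<^sup>2 / s)))
      + ennreal (2 * (cmod w)\<^sup>2 / (pi * s)) * ennreal (exp (- ((cmod z)\<^sup>2 / s)))" (is "?l = ?r") for z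
  proof -
    have "?l = ennreal (((cmod (a * z + w))\<^sup>2 + (cmod (- (a * z) + w))\<^sup>2) * ?e z)"
      unfolding distrib_right using assms by (intro gen) auto
    also have "((cmod (a * z + w))\<^sup>2 + (cmod (- (a * z) + w))\<^sup>2) * ?e z
        = 2 * (cmod a)\<^sup>2 / (pi * s) * ((cmod z)\<^sup>2 * exp (- ((cmod z)\<^sup>2 / s)))
        + 2 * (cmod w)\<^sup>2 / (pi * s) * exp (- ((cmod z)\<^sup>2 / s))"
      unfolding par using assms by (simp add: field_simps)
    also have "ennreal \<dots> = ?r"
      using assms by (intro gen[symmetric]) auto
    finally show ?thesis .
  qed
  have "I = (\<integral>\<^sup>+z. ennreal ((cmod (- (a * z) + w))\<^sup>2) * ennreal (?e z) \<partial>lborel)"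
    unfolding I_def by (subst nn_integral_lborel_affine[where c="-1" and t=0]) simp_all
  then have "I + I = (\<integral>\<^sup>+z. ennreal ((cmod (a * z + w))\<^sup>2) * ennreal (?e z)
      + ennreal ((cmod (- (a * z) + w))\<^sup>2) * ennreal (?e z) \<partial>lborel)"
    by (subst nn_integral_add) (simp_all add: I_def)
  also have "\<dots> = ennreal (2 * (cmod a)\<^sup>2 / (pi * s)) * ennreal (pi * s * s)
      + ennreal (2 * (cmod w)\<^sup>2 / (pi * s)) * ennreal (pi * s)"
    unfolding sum_eq using assms
    by (subst nn_integral_add) (simp_all add: nn_integral_cmult nn_integral_gauss_complex)
  also have "\<dots> = ennreal (2 * (cmod a)\<^sup>2 / (pi * s) * (pi * s * s) + 2 * (cmod w)\<^sup>2 / (pi * s) * (pi * s))"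
    using assms by (intro gen) auto
  also have "2 * (cmod a)\<^sup>2 / (pi * s) * (pi * s * s) + 2 * (cmod w)\<^sup>2 / (pi * s) * (pi * s)
      = 2 * ((cmod a)\<^sup>2 * s + (cmod w)\<^sup>2)"
    using assms by (simp add: field_simps)
  also have "ennreal (2 * ((cmod a)\<^sup>2 * s + (cmod w)\<^sup>2)) = 2 * ennreal ((cmod a)\<^sup>2 * s + (cmod w)\<^sup>2)"
    by (subst ennreal_mult') simp_all
  finally have "2 * I = 2 * ennreal ((cmod a)\<^sup>2 * s + (cmod w)\<^sup>2)"
    by (simp only: mult_2)
  then have "I = ennreal ((cmod a)\<^sup>2 * s + (cmod w)\<^sup>2)"
    by (subst (asm) ennreal_mult_cancel_left) simp_all
  then show ?thesis
    by (simp only: I_def)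
qed

section \<open>Triangular Gaussian integrals over the product measure \<open>lebC\<close>\<close>

lemma measurable_lebC_component:
  "j < n \<Longrightarrow> (\<lambda>x. x j) \<in> borel_measurable (lebC n)"
  unfolding lebC_def using measurable_component_singleton[of j "{..<n}" "\<lambda>_. lborel :: complex measure"]
  by simp

lemma measurable_lebC_sum:
  assumes "\<And>j. j \<in> I \<Longrightarrow> j < n"
  shows "(\<lambda>x. \<Sum>j\<in>I. a j * x j) \<in> borel_measurable (lebC n)"
  by (intro borel_measurable_sum borel_measurable_times borel_measurable_const measurable_lebC_component assms)

lemma measurable_gauss_triangular:
  "(\<lambda>x. \<Prod>i<n. exp (- (cmod ((\<Sum>j\<le>i. a i j * x j) + c i))\<^sup>2)) \<in> borel_measurable (lebC n)"
proof (rule borel_measurable_prod)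
  fix i assume "i \<in> {..<n}"
  then have [measurable]: "(\<lambda>x. \<Sum>j\<le>i. a i j * x j) \<in> borel_measurable (lebC n)"
    by (intro measurable_lebC_sum) auto
  show "(\<lambda>x. exp (- (cmod ((\<Sum>j\<le>i. a i j * x j) + c i))\<^sup>2)) \<in> borel_measurable (lebC n)"
    by measurable
qed

lemma measurable_lebC_fun_upd:
  "(\<lambda>(x, z). x(n := z)) \<in> measurable (lebC n \<Otimes>\<^sub>M lborel) (lebC (Suc n))"
  unfolding lebC_def lessThan_Suc by (rule measurable_add_dim)

text \<open>The empty product measure is the unit point mass at the only extensional function on the
  empty index set, which is \<open>undefined\<close> everywhere.\<close>

lemma nn_integral_lebC_0: "(\<integral>\<^sup>+x. f x \<partial>lebC 0) = f (\<lambda>_. undefined)"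
proof -
  interpret product_sigma_finite "\<lambda>_::nat. lborel :: complex measure" ..
  show ?thesis by (simp add: lebC_def nn_integral_empty)
qed

lemma nn_integral_lebC_Suc:
  assumes "f \<in> borel_measurable (lebC (Suc n))"
  shows "(\<integral>\<^sup>+x. f x \<partial>lebC (Suc n)) = (\<integral>\<^sup>+x. (\<integral>\<^sup>+z. f (x(n := z)) \<partial>lborel) \<partial>lebC n)"
proof -
  interpret product_sigma_finite "\<lambda>_::nat. lborel :: complex measure" ..
  show ?thesis
    using assms unfolding lebC_def lessThan_Suc by (subst product_nn_integral_insert) auto
qed

text \<open>The last coordinate occurs in the last factor only, so integrating it first peels off that factor.
  A vanishing diagonal entry makes the innermost integral infinite.\<close>

lemma nn_integral_gauss_triangular:
  "(\<integral>\<^sup>+x. (\<Prod>i<n. ennreal (exp (- (cmod ((\<Sum>j\<le>i. a i j * x j) + c i))\<^sup>2))) \<partial>lebC n)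
    = (\<Prod>i<n. if a i i = 0 then \<infinity> else ennreal (pi / (cmod (a i i))\<^sup>2))"
proof (induction n)
  case 0
  show ?case by (subst nn_integral_lebC_0) simp
next
  case (Suc n)
  let ?E = "\<lambda>i x. ennreal (exp (- (cmod ((\<Sum>j\<le>i. a i j * x j) + c i))\<^sup>2))"
  have meas: "(\<lambda>x. \<Prod>i<m. ?E i x) \<in> borel_measurable (lebC m)" for m
    using measurable_compose[OF measurable_gauss_triangular measurable_ennreal] by (simp add: prod_ennreal)
  have "(\<integral>\<^sup>+x. (\<Prod>i<Suc n. ?E i x) \<partial>lebC (Suc n))
      = (\<integral>\<^sup>+x. (\<integral>\<^sup>+z. (\<Prod>i<Suc n. ?E i (x(n := z))) \<partial>lborel) \<partial>lebC n)"
    by (rule nn_integral_lebC_Suc[OF meas])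
  also have "\<dots> = (\<integral>\<^sup>+x. (\<Prod>i<n. ?E i x) *
      (if a n n = 0 then \<infinity> else ennreal (pi / (cmod (a n n))\<^sup>2)) \<partial>lebC n)"
  proof (rule nn_integral_cong)
    fix x
    have "(\<Prod>i<Suc n. ?E i (x(n := z)))
        = (\<Prod>i<n. ?E i x) * ennreal (exp (- (cmod (a n n * z + ((\<Sum>j<n. a n j * x j) + c n)))\<^sup>2))" for z
    proof -
      have "(\<Sum>j\<le>i. a i j * (x(n := z)) j) = (\<Sum>j\<le>i. a i j * x j)" if "i < n" for i
        using that by (intro sum.cong) auto
      moreover have "{..n} = insert n {..<n}" by auto
      then have "(\<Sum>j\<le>n. a n j * (x(n := z)) j) + c n = a n n * z + ((\<Sum>j<n. a n j * x j) + c n)"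
        by simp
      ultimately show ?thesis
        unfolding prod.lessThan_Suc by (intro arg_cong2[of _ _ _ _ "(*)"] prod.cong) (auto simp: add.assoc)
    qed
    then show "(\<integral>\<^sup>+z. (\<Prod>i<Suc n. ?E i (x(n := z))) \<partial>lborel) = (\<Prod>i<n. ?E i x) *
        (if a n n = 0 then \<infinity> else ennreal (pi / (cmod (a n n))\<^sup>2))"
      by (simp only:) (subst nn_integral_cmult, simp, subst nn_integral_gauss_complex_affine, simp)
  qed
  also have "\<dots> = (\<Prod>i<Suc n. if a i i = 0 then \<infinity> else ennreal (pi / (cmod (a i i))\<^sup>2))"
    by (subst nn_integral_multc[OF meas]) (simp add: Suc)
  finally show ?case .
qed

section \<open>Second moments of complex Gaussian vectors\<close>

lemma measurable_cgauss_dens [measurable]: "cgauss_dens n s \<in> borel_measurable (lebC n)"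
  unfolding cgauss_dens_def[abs_def]
proof (rule borel_measurable_prod)
  fix i assume "i \<in> {..<n}"
  then have [measurable]: "(\<lambda>x. x i) \<in> borel_measurable (lebC n)"
    by (simp add: measurable_lebC_component)
  show "(\<lambda>x. exp (- (cmod (x i))\<^sup>2 / s) / (pi * s)) \<in> borel_measurable (lebC n)"
    by measurable
qed

lemma cgauss_dens_nonneg: "s > 0 \<Longrightarrow> cgauss_dens n s x \<ge> 0"
  unfolding cgauss_dens_def by (intro prod_nonneg) auto

lemma sets_cgauss [measurable_cong]: "sets (cgauss n s) = sets (lebC n)"
  by (simp add: cgauss_def)

lemma nn_integral_cgauss_0: "f \<in> borel_measurable (lebC 0) \<Longrightarrow> (\<integral>\<^sup>+x. f x \<partial>cgauss 0 s) = f (\<lambda>_. undefined)"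
  unfolding cgauss_def by (subst nn_integral_density) (simp_all add: nn_integral_lebC_0, simp add: cgauss_dens_def)

text \<open>The density is a product over coordinates, so the last coordinate can be integrated
  against its own one-dimensional Gaussian. This is the step of the inductions on \<open>n\<close>
  that follow.\<close>

lemma nn_integral_cgauss_Suc:
  assumes [measurable]: "f \<in> borel_measurable (lebC (Suc n))" and "s > 0"
  shows "(\<integral>\<^sup>+x. f x \<partial>cgauss (Suc n) s)
    = (\<integral>\<^sup>+x. (\<integral>\<^sup>+z. f (x(n := z)) * ennreal (exp (- ((cmod z)\<^sup>2 / s)) / (pi * s)) \<partial>lborel) \<partial>cgauss n s)"
proof -
  let ?g = "\<lambda>z. ennreal (exp (- ((cmod z)\<^sup>2 / s)) / (pi * s))"
  have f2: "(\<lambda>(x, z). f (x(n := z))) \<in> borel_measurable (lebC n \<Otimes>\<^sub>M lborel)"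
    using measurable_compose[OF measurable_lebC_fun_upd assms(1)] by (simp add: case_prod_beta')
  then have f2' [measurable]: "(\<lambda>p. f ((fst p)(n := snd p))) \<in> borel_measurable (lebC n \<Otimes>\<^sub>M lborel)"
    by (simp add: case_prod_beta')
  have dens: "ennreal (cgauss_dens (Suc n) s (x(n := z))) = ennreal (cgauss_dens n s x) * ?g z" for x z
  proof -
    have "cgauss_dens (Suc n) s (x(n := z)) = cgauss_dens n s x * (exp (- ((cmod z)\<^sup>2 / s)) / (pi * s))"
      unfolding cgauss_dens_def prod.lessThan_Suc by (intro arg_cong2[of _ _ _ _ "(*)"] prod.cong) auto
    moreover have "ennreal (cgauss_dens n s x * (exp (- ((cmod z)\<^sup>2 / s)) / (pi * s))) = ennreal (cgauss_dens n s x) * ?g z"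
      using assms(2) by (intro ennreal_mult cgauss_dens_nonneg) auto
    ultimately show ?thesis
      by simp
  qed
  have "(\<integral>\<^sup>+x. f x \<partial>cgauss (Suc n) s) = (\<integral>\<^sup>+x. ennreal (cgauss_dens (Suc n) s x) * f x \<partial>lebC (Suc n))"
    unfolding cgauss_def by (rule nn_integral_density) auto
  also have "\<dots> = (\<integral>\<^sup>+x. (\<integral>\<^sup>+z. ennreal (cgauss_dens n s x) * (f (x(n := z)) * ?g z) \<partial>lborel) \<partial>lebC n)"
    by (subst nn_integral_lebC_Suc) (simp_all add: dens mult_ac)
  also have "\<dots> = (\<integral>\<^sup>+x. ennreal (cgauss_dens n s x) * (\<integral>\<^sup>+z. f (x(n := z)) * ?g z \<partial>lborel) \<partial>lebC n)"
  proof (intro nn_integral_cong nn_integral_cmult)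
    fix x assume "x \<in> space (lebC n)"
    then have "(\<lambda>z. f (x(n := z))) \<in> borel_measurable lborel"
      using measurable_Pair2[OF f2] by simp
    then show "(\<lambda>z. f (x(n := z)) * ?g z) \<in> borel_measurable lborel"
      by simp
  qed
  also have "\<dots> = (\<integral>\<^sup>+x. (\<integral>\<^sup>+z. f (x(n := z)) * ?g z \<partial>lborel) \<partial>cgauss n s)"
    unfolding cgauss_def
    by (rule nn_integral_density[symmetric])
       (auto intro!: sigma_finite_measure.borel_measurable_nn_integral sigma_finite_lborel simp: case_prod_beta')
  finally show ?thesis .
qed

lemma prob_space_cgauss:
  assumes "s > 0"
  shows "prob_space (cgauss n s)"
proof
  have "(\<integral>\<^sup>+x. 1 \<partial>cgauss n s) = 1"
  proof (induction n)
    case 0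
    then show ?case by (subst nn_integral_cgauss_0) auto
  next
    case (Suc n)
    have "(\<integral>\<^sup>+z. ennreal (exp (- ((cmod z)\<^sup>2 / s)) / (pi * s)) \<partial>lborel)
        = (\<integral>\<^sup>+z. ennreal (1 / (pi * s)) * ennreal (exp (- ((cmod z)\<^sup>2 / s))) \<partial>lborel)"
      using assms by (simp flip: ennreal_mult)
    also have "\<dots> = 1"
      using assms by (subst nn_integral_cmult) (simp_all add: nn_integral_gauss_complex flip: ennreal_mult)
    finally show ?case
      using assms Suc by (subst nn_integral_cgauss_Suc) simp_all
  qed
  then show "emeasure (cgauss n s) (space (cgauss n s)) = 1" by simp
qed

text \<open>Integrating the last coordinate, with all the others counted as offset, returns its own
  variance term plus the same expression with one coordinate fewer. The offset \<open>w\<close>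
  later holds the signal part while the noise is being integrated.\<close>

lemma nn_integral_cgauss_sq_affine:
  assumes "s > 0"
  shows "(\<integral>\<^sup>+x. ennreal ((cmod ((\<Sum>j<n. a j * x j) + w))\<^sup>2) \<partial>cgauss n s)
    = ennreal (s * (\<Sum>j<n. (cmod (a j))\<^sup>2) + (cmod w)\<^sup>2)"
proof (induction n)
  case 0
  then show ?case by (subst nn_integral_cgauss_0) auto
next
  case (Suc n)
  interpret prob_space "cgauss n s" by (rule prob_space_cgauss[OF assms])
  have [measurable]: "(\<lambda>x. \<Sum>j<m. a j * x j) \<in> borel_measurable (lebC m)" for m
    by (intro measurable_lebC_sum) auto
  have meas: "(\<lambda>x. ennreal ((cmod ((\<Sum>j<Suc n. a j * x j) + w))\<^sup>2)) \<in> borel_measurable (lebC (Suc n))"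
    by measurable
  have "(\<integral>\<^sup>+x. ennreal ((cmod ((\<Sum>j<Suc n. a j * x j) + w))\<^sup>2) \<partial>cgauss (Suc n) s)
      = (\<integral>\<^sup>+x. (\<integral>\<^sup>+z. ennreal ((cmod (a n * z + ((\<Sum>j<n. a j * x j) + w)))\<^sup>2)
          * ennreal (exp (- ((cmod z)\<^sup>2 / s)) / (pi * s)) \<partial>lborel) \<partial>cgauss n s)"
    unfolding nn_integral_cgauss_Suc[OF meas assms] by (simp add: add_ac)
  also have "\<dots> = (\<integral>\<^sup>+x. ennreal ((cmod (a n))\<^sup>2 * s) + ennreal ((cmod ((\<Sum>j<n. a j * x j) + w))\<^sup>2) \<partial>cgauss n s)"
    using assms by (simp add: nn_integral_sq_gauss_complex_affine)
  also have "\<dots> = ennreal ((cmod (a n))\<^sup>2 * s) + ennreal (s * (\<Sum>j<n. (cmod (a j))\<^sup>2) + (cmod w)\<^sup>2)"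
    by (subst nn_integral_add) (simp_all add: Suc emeasure_space_1)
  also have "\<dots> = ennreal (s * (\<Sum>j<Suc n. (cmod (a j))\<^sup>2) + (cmod w)\<^sup>2)"
    using assms by (simp add: algebra_simps sum_nonneg flip: ennreal_plus)
  finally show ?case .
qed

lemma prob_space_joint_xz:
  assumes "Es > 0" "N0 > 0"
  shows "prob_space (joint_xz Nr Nt Es N0)"
proof -
  interpret x: prob_space "cgauss Nt Es" by (rule prob_space_cgauss[OF assms(1)])
  interpret z: prob_space "cgauss Nr N0" by (rule prob_space_cgauss[OF assms(2)])
  interpret pair_prob_space "cgauss Nt Es" "cgauss Nr N0" ..
  show ?thesis unfolding joint_xz_def by unfold_locales
qed

text \<open>For fixed signal the noise integral sees the signal part as a constant offset; the
  signal is then integrated with offset 0. Every nonconstant expectation needed for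
  \<open>I_LB\<close> is a combination of such squares.\<close>

lemma has_bochner_integral_joint_xz_sq:
  assumes "Es > 0" "N0 > 0"
  shows "has_bochner_integral (joint_xz Nr Nt Es N0)
    (\<lambda>p. (cmod ((\<Sum>j<Nt. a j * fst p j) + (\<Sum>k<Nr. b k * snd p k)))\<^sup>2)
    (Es * (\<Sum>j<Nt. (cmod (a j))\<^sup>2) + N0 * (\<Sum>k<Nr. (cmod (b k))\<^sup>2))"
proof (rule has_bochner_integral_nn_integral)
  let ?f = "\<lambda>p. (cmod ((\<Sum>j<Nt. a j * fst p j) + (\<Sum>k<Nr. b k * snd p k)))\<^sup>2"
  interpret x: prob_space "cgauss Nt Es" by (rule prob_space_cgauss[OF assms(1)])
  interpret z: prob_space "cgauss Nr N0" by (rule prob_space_cgauss[OF assms(2)])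
  have [measurable]: "(\<lambda>x. \<Sum>j<Nt. a j * x j) \<in> borel_measurable (cgauss Nt Es)"
    "(\<lambda>z. \<Sum>k<Nr. b k * z k) \<in> borel_measurable (cgauss Nr N0)"
    using measurable_lebC_sum[of "{..<Nt}" Nt a] measurable_lebC_sum[of "{..<Nr}" Nr b]
    by (simp_all cong: measurable_cong_sets add: sets_cgauss)
  have meas: "?f \<in> borel_measurable (cgauss Nt Es \<Otimes>\<^sub>M cgauss Nr N0)"
    by measurable
  then show "?f \<in> borel_measurable (joint_xz Nr Nt Es N0)"
    by (simp add: joint_xz_def)
  have "(\<integral>\<^sup>+p. ennreal (?f p) \<partial>joint_xz Nr Nt Es N0)
      = (\<integral>\<^sup>+x. (\<integral>\<^sup>+z. ennreal (?f (x, z)) \<partial>cgauss Nr N0) \<partial>cgauss Nt Es)"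
    unfolding joint_xz_def using meas by (subst z.nn_integral_fst) auto
  also have "\<dots> = (\<integral>\<^sup>+x. ennreal (N0 * (\<Sum>k<Nr. (cmod (b k))\<^sup>2))
      + ennreal ((cmod ((\<Sum>j<Nt. a j * x j) + 0))\<^sup>2) \<partial>cgauss Nt Es)"
  proof (rule nn_integral_cong)
    fix x
    show "(\<integral>\<^sup>+z. ennreal (?f (x, z)) \<partial>cgauss Nr N0) = ennreal (N0 * (\<Sum>k<Nr. (cmod (b k))\<^sup>2))
      + ennreal ((cmod ((\<Sum>j<Nt. a j * x j) + 0))\<^sup>2)"
      using nn_integral_cgauss_sq_affine[OF assms(2), of Nr b "\<Sum>j<Nt. a j * x j"] assms(2)
      by (simp add: add.commute sum_nonneg)
  qed
  also have "\<dots> = ennreal (N0 * (\<Sum>k<Nr. (cmod (b k))\<^sup>2)) + ennreal (Es * (\<Sum>j<Nt. (cmod (a j))\<^sup>2))"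
    by (subst nn_integral_add)
       (simp_all only: nn_integral_cgauss_sq_affine[OF assms(1)], simp_all add: x.emeasure_space_1)
  also have "\<dots> = ennreal (Es * (\<Sum>j<Nt. (cmod (a j))\<^sup>2) + N0 * (\<Sum>k<Nr. (cmod (b k))\<^sup>2))"
    using assms by (simp add: add.commute sum_nonneg flip: ennreal_plus)
  finally show "(\<integral>\<^sup>+p. ennreal (?f p) \<partial>joint_xz Nr Nt Es N0)
      = ennreal (Es * (\<Sum>j<Nt. (cmod (a j))\<^sup>2) + N0 * (\<Sum>k<Nr. (cmod (b k))\<^sup>2))" .
qed (use assms in \<open>auto intro!: add_nonneg_nonneg mult_nonneg_nonneg sum_nonneg\<close>)

subsection \<open>Matrices\<close>

definition sqnorm_vec :: "complex Matrix.vec \<Rightarrow> real" where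
  "sqnorm_vec v = (\<Sum>i<dim_vec v. (cmod (v $ i))\<^sup>2)"

definition frob :: "complex mat \<Rightarrow> real" where
  "frob A = (\<Sum>i<dim_row A. \<Sum>j<dim_col A. (cmod (A $$ (i,j)))\<^sup>2)"

lemma frob_nonneg: "0 \<le> frob A"
  by (auto simp: frob_def intro!: sum_nonneg)

lemma adjC_carrier [simp]: "A \<in> carrier_mat n m \<Longrightarrow> adjC A \<in> carrier_mat m n"
  by (auto simp: adjC_def)

lemma adjC_index [simp]: "i < dim_col A \<Longrightarrow> j < dim_row A \<Longrightarrow> adjC A $$ (i,j) = cnj (A $$ (j,i))"
  by (simp add: adjC_def)

lemma dim_adjC [simp]: "dim_row (adjC A) = dim_col A" "dim_col (adjC A) = dim_row A"
  by (auto simp: adjC_def)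

lemma adjC_adjC [simp]: "adjC (adjC A) = A"
  by (rule eq_matI) auto

lemma adjC_mult: "A \<in> carrier_mat n m \<Longrightarrow> B \<in> carrier_mat m k \<Longrightarrow> adjC (A * B) = adjC B * adjC A"
  by (rule eq_matI) (auto simp: scalar_prod_def mult.commute)

lemma adjC_minus: "A \<in> carrier_mat n m \<Longrightarrow> B \<in> carrier_mat n m \<Longrightarrow> adjC (A - B) = adjC A - adjC B"
  by (rule eq_matI) auto

lemma adjC_one [simp]: "adjC (1\<^sub>m n) = 1\<^sub>m n"
  by (rule eq_matI) auto

text \<open>The right side is the trace of \<open>A * adjC A\<close>. Through it the two norm
  comparisons below become matrix identities.\<close>

lemma frob_eq:
  "complex_of_real (frob A) = (\<Sum>i<dim_row A. (A * adjC A) $$ (i,i))"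
  by (auto simp: frob_def scalar_prod_def atLeast0LessThan complex_norm_square[symmetric] intro!: sum.cong)

text \<open>The rows of \<open>adjC Q\<close> are orthonormal, so right multiplication by it
  preserves the norm of each row: the inner factor \<open>adjC Q * Q\<close> cancels in the Gram
  matrix. This provides the equality case of the optimisation.\<close>

lemma frob_mult_adjC:
  assumes U: "U \<in> carrier_mat n m" and Q: "Q \<in> carrier_mat k m" and QQ: "adjC Q * Q = 1\<^sub>m m"
  shows "frob (U * adjC Q) = frob U"
proof -
  have "U * adjC Q * adjC (U * adjC Q) = (U * adjC Q) * (Q * adjC U)"
    using U Q by (simp add: adjC_mult[of _ n m _ k])
  also have "\<dots> = U * (adjC Q * (Q * adjC U))"
    by (rule assoc_mult_mat) (use U Q in auto)
  also have "adjC Q * (Q * adjC U) = adjC Q * Q * adjC U"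
    by (rule assoc_mult_mat[symmetric]) (use U Q in auto)
  also have "\<dots> = adjC U"
    using U by (simp add: QQ)
  finally have "complex_of_real (frob (U * adjC Q)) = complex_of_real (frob U)"
    using U by (simp add: frob_eq)
  then show ?thesis by simp
qed

text \<open>Bessel's inequality through Pythagoras. The rows of \<open>V = U * Q * adjC Q\<close>
  are the orthogonal projections of the rows of \<open>U\<close>, and the three products
  \<open>UV\<close>, \<open>VU\<close>, \<open>VV\<close> all collapse to \<open>T * adjC T\<close>,
  so \<open>frob (U - V)\<close> is exactly the loss \<open>frob U - frob T\<close>.\<close>

lemma frob_mult_le:
  assumes U: "U \<in> carrier_mat n k" and Q: "Q \<in> carrier_mat k m" and QQ: "adjC Q * Q = 1\<^sub>m m"
  shows "frob (U * Q) \<le> frob U"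
proof -
  define T where "T = U * Q"
  have T: "T \<in> carrier_mat n m" using U Q by (simp add: T_def)
  define V where "V = T * adjC Q"
  have V: "V \<in> carrier_mat n k" using T Q by (simp add: V_def)
  have aT: "adjC T = adjC Q * adjC U"
    unfolding T_def by (rule adjC_mult[OF U Q])
  have aV: "adjC V = Q * adjC T"
    unfolding V_def using adjC_mult[OF T adjC_carrier[OF Q]] by simp
  have UV: "U * adjC V = T * adjC T"
    unfolding aV T_def[symmetric] using assoc_mult_mat[OF U Q adjC_carrier[OF T]] by (simp add: T_def)
  have VU: "V * adjC U = T * adjC T"
    unfolding V_def aT using T Q U by (intro assoc_mult_mat) auto
  have VV: "V * adjC V = T * adjC T"
  proof -
    have "V * adjC V = T * (adjC Q * (Q * adjC T))"
      unfolding aV unfolding V_def using T Q by (intro assoc_mult_mat) auto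
    also have "adjC Q * (Q * adjC T) = adjC Q * Q * adjC T"
      using T Q by (intro assoc_mult_mat[symmetric]) auto
    finally show ?thesis using T by (simp add: QQ)
  qed
  have "(U - V) * adjC (U - V) = U * adjC (U - V) - V * adjC (U - V)"
    using U V by (intro minus_mult_distrib_mat) auto
  also have "U * adjC (U - V) = U * adjC U - U * adjC V"
    unfolding adjC_minus[OF U V] using U V by (intro mult_minus_distrib_mat) auto
  also have "V * adjC (U - V) = V * adjC U - V * adjC V"
    unfolding adjC_minus[OF U V] using U V by (intro mult_minus_distrib_mat) auto
  finally have "complex_of_real (frob (U - V)) = complex_of_real (frob U - frob T)"
    unfolding of_real_diff using U V T
    by (simp add: frob_eq UV VU VV sum_subtractf)
  then have "frob (U - V) = frob U - frob T"
    using of_real_eq_iff by blast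
  then show ?thesis
    using frob_nonneg[of "U - V"] by (simp add: T_def)
qed

section \<open>Inverses, triangular determinants and quadratic forms\<close>

lemma invC:
  assumes "A \<in> carrier_mat n n" "det A \<noteq> 0"
  shows "invC A \<in> carrier_mat n n" "A * invC A = 1\<^sub>m n" "invC A * A = 1\<^sub>m n"
proof -
  note adj = adj_mat[OF assms(1)]
  show "invC A \<in> carrier_mat n n" using adj by (simp add: invC_def)
  have "A * invC A = (1 / det A) \<cdot>\<^sub>m (A * adj_mat A)"
    unfolding invC_def using assms adj(1) by (intro mult_smult_distrib)
  then show "A * invC A = 1\<^sub>m n" using assms unfolding adj by (intro eq_matI) auto
  have "invC A * A = (1 / det A) \<cdot>\<^sub>m (adj_mat A * A)"
    unfolding invC_def using assms adj(1) by (intro mult_smult_assoc_mat)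
  then show "invC A * A = 1\<^sub>m n" using assms unfolding adj by (intro eq_matI) auto
qed

lemma det_lower_tri:
  assumes "A \<in> carrier_mat n n" "lower_tri A"
  shows "det A = (\<Prod>i<n. A $$ (i,i))"
  using det_lower_triangular[of n A] assms
  by (auto simp: prod_list_diag_prod lower_tri_def atLeast0LessThan)

lemma det_adjC:
  assumes "A \<in> carrier_mat n n" "lower_tri A"
  shows "det (adjC A) = cnj (det A)"
proof -
  have "upper_triangular (adjC A)"
    using assms by (auto simp: upper_triangular_def lower_tri_def)
  then have "det (adjC A) = (\<Prod>i<n. cnj (A $$ (i,i)))"
    using det_upper_triangular[of "adjC A" n] assms by (auto simp: prod_list_diag_prod atLeast0LessThan)
  then show ?thesis by (simp add: det_lower_tri[OF assms])
qed

lemma mat_cancel_left: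
  assumes "A \<in> carrier_mat n n" "det A \<noteq> (0::complex)" "B \<in> carrier_mat n m" "C \<in> carrier_mat n m" "A * B = A * C"
  shows "B = C"
proof -
  note inv = invC[OF assms(1,2)]
  have "invC A * (A * B) = invC A * (A * C)" by (simp add: assms)
  then show ?thesis
    using assoc_mult_mat[OF inv(1) assms(1,3)] assoc_mult_mat[OF inv(1) assms(1,4)] assms inv by simp
qed

lemma adjC_scalar_prod:
  assumes "A \<in> carrier_mat n m" "u \<in> carrier_vec n" "v \<in> carrier_vec m"
  shows "scalar_prod (map_vec cnj u) (A *\<^sub>v v) = scalar_prod (map_vec cnj (adjC A *\<^sub>v u)) v"
proof -
  have "scalar_prod (map_vec cnj u) (A *\<^sub>v v) = (\<Sum>i<n. \<Sum>j<m. cnj (u $ i) * A $$ (i,j) * v $ j)"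
    using assms by (auto simp: scalar_prod_def atLeast0LessThan sum_distrib_left mult.assoc intro!: sum.cong)
  also have "\<dots> = (\<Sum>j<m. \<Sum>i<n. cnj (u $ i) * A $$ (i,j) * v $ j)"
    by (rule sum.swap)
  also have "\<dots> = scalar_prod (map_vec cnj (adjC A *\<^sub>v u)) v"
    using assms by (auto simp: scalar_prod_def atLeast0LessThan sum_distrib_left mult_ac intro!: sum.cong)
  finally show ?thesis .
qed

lemma scalar_prod_cnj_self: "scalar_prod (map_vec cnj v) v = complex_of_real (sqnorm_vec v)"
  by (auto simp: scalar_prod_def sqnorm_vec_def atLeast0LessThan complex_norm_square[symmetric] mult.commute intro!: sum.cong)

lemma sqnorm_vec_minus:
  assumes "dim_vec u = dim_vec v"
  shows "sqnorm_vec (u - v) = sqnorm_vec u - 2 * Re (scalar_prod (map_vec cnj v) u) + sqnorm_vec v"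
proof -
  have "(cmod (a - b))\<^sup>2 = (cmod a)\<^sup>2 - 2 * Re (cnj b * a) + (cmod b)\<^sup>2" for a b
    unfolding cmod_power2 by (simp add: power2_eq_square algebra_simps)
  then show ?thesis
    using assms
    by (simp add: sqnorm_vec_def scalar_prod_def atLeast0LessThan sum.distrib sum_subtractf sum_distrib_left)
qed

text \<open>Completing the square; \<open>C y\<close> is the centre of the quadratic form in the coordinates \<open>J x\<close>.\<close>

lemma ln_pm_cond:
  assumes J: "J \<in> carrier_mat n n" and C: "C \<in> carrier_mat n m" and F: "F \<in> carrier_mat m n"
    and CF: "adjC J * C = adjC F" and x: "x \<in> carrier_vec n" and y: "y \<in> carrier_vec m"
  shows "ln (pm_cond F (adjC J * J) Es y x)
    = sqnorm_vec x / Es + sqnorm_vec (C *\<^sub>v y) - sqnorm_vec (J *\<^sub>v x - C *\<^sub>v y)"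
proof -
  have "scalar_prod (map_vec cnj y) (F *\<^sub>v x) = scalar_prod (map_vec cnj (adjC F *\<^sub>v y)) x"
    by (rule adjC_scalar_prod[OF F y x])
  also have "adjC F *\<^sub>v y = adjC J *\<^sub>v (C *\<^sub>v y)"
    unfolding CF[symmetric] using J C y by (intro assoc_mult_mat_vec) auto
  also have "scalar_prod (map_vec cnj \<dots>) x = scalar_prod (map_vec cnj (C *\<^sub>v y)) (J *\<^sub>v x)"
    using J C x y by (intro adjC_scalar_prod[symmetric]) auto
  finally have 1: "scalar_prod (map_vec cnj y) (F *\<^sub>v x) = scalar_prod (map_vec cnj (C *\<^sub>v y)) (J *\<^sub>v x)" .
  have "scalar_prod (map_vec cnj x) ((adjC J * J) *\<^sub>v x) = scalar_prod (map_vec cnj x) (adjC J *\<^sub>v (J *\<^sub>v x))"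
    using J x by (subst assoc_mult_mat_vec) auto
  also have "\<dots> = complex_of_real (sqnorm_vec (J *\<^sub>v x))"
    using adjC_scalar_prod[of "adjC J" n n x "J *\<^sub>v x"] J x by (simp add: scalar_prod_cnj_self)
  finally have 2: "scalar_prod (map_vec cnj x) ((adjC J * J) *\<^sub>v x) = complex_of_real (sqnorm_vec (J *\<^sub>v x))" .
  have "sqnorm_vec (J *\<^sub>v x - C *\<^sub>v y) = sqnorm_vec (J *\<^sub>v x)
      - 2 * Re (scalar_prod (map_vec cnj (C *\<^sub>v y)) (J *\<^sub>v x)) + sqnorm_vec (C *\<^sub>v y)"
    using J C by (intro sqnorm_vec_minus) auto
  then show ?thesis
    by (simp add: pm_cond_def 1 2 scalar_prod_cnj_self)
qed

subsection \<open>The lower bound as a Frobenius norm\<close>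

text \<open>The term \<open>sqnorm_vec x / Es\<close> left by completing the square cancels against
  the exponent of the prior density. As \<open>J\<close> is lower triangular, component
  \<open>i\<close> of \<open>J x\<close> involves only the coordinates up to \<open>i\<close>, so
  what remains is a constant times the product treated by
  \<open>nn_integral_gauss_triangular\<close>.\<close>

lemma pm_cond_mult_cgauss_dens:
  assumes J: "J \<in> carrier_mat n n" "lower_tri J" and C: "C \<in> carrier_mat n m" and F: "F \<in> carrier_mat m n"
    and CF: "adjC J * C = adjC F" and y: "y \<in> carrier_vec m" and Es: "Es > 0"
  shows "pm_cond F (adjC J * J) Es y (Matrix.vec n x) * cgauss_dens n Es x
    = exp (sqnorm_vec (C *\<^sub>v y)) / (pi * Es) ^ n *
      (\<Prod>i<n. exp (- (cmod ((\<Sum>j\<le>i. J $$ (i,j) * x j) + - (C *\<^sub>v y) $ i))\<^sup>2))"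
proof -
  have sq: "sqnorm_vec (J *\<^sub>v Matrix.vec n x - C *\<^sub>v y)
      = (\<Sum>i<n. (cmod ((\<Sum>j\<le>i. J $$ (i,j) * x j) + - (C *\<^sub>v y) $ i))\<^sup>2)"
  proof -
    have "(J *\<^sub>v Matrix.vec n x) $ i = (\<Sum>j\<le>i. J $$ (i,j) * x j)" if "i < n" for i
    proof -
      have "(J *\<^sub>v Matrix.vec n x) $ i = (\<Sum>j<n. J $$ (i,j) * x j)"
        using J that by (simp add: scalar_prod_def atLeast0LessThan)
      also have "\<dots> = (\<Sum>j\<le>i. J $$ (i,j) * x j)"
        using J that by (intro sum.mono_neutral_right) (auto simp: lower_tri_def)
      finally show ?thesis .
    qed
    then show ?thesis
      using C y J by (simp add: sqnorm_vec_def del: index_mult_mat_vec)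
  qed
  have "pm_cond F (adjC J * J) Es y (Matrix.vec n x)
      = exp (ln (pm_cond F (adjC J * J) Es y (Matrix.vec n x)))"
    by (simp add: pm_cond_def)
  also have "\<dots> = exp (sqnorm_vec (Matrix.vec n x) / Es + sqnorm_vec (C *\<^sub>v y)
      - sqnorm_vec (J *\<^sub>v Matrix.vec n x - C *\<^sub>v y))"
    by (subst ln_pm_cond[OF J(1) C F CF _ y]) auto
  finally have 1: "pm_cond F (adjC J * J) Es y (Matrix.vec n x) = exp (sqnorm_vec (Matrix.vec n x) / Es) *
      exp (sqnorm_vec (C *\<^sub>v y)) * exp (- sqnorm_vec (J *\<^sub>v Matrix.vec n x - C *\<^sub>v y))"
    by (simp add: mult_exp_exp)
  have 2: "cgauss_dens n Es x = exp (- (sqnorm_vec (Matrix.vec n x) / Es)) / (pi * Es) ^ n"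
    by (simp add: cgauss_dens_def sqnorm_vec_def sum_divide_distrib sum_negf[symmetric] exp_sum
        prod_dividef)
  show ?thesis
    unfolding 1 2 unfolding sq by (simp add: exp_minus exp_sum sum_negf[symmetric] prod_inversef[symmetric])
qed

text \<open>Working in \<open>ennreal\<close> keeps zero diagonal entries in the picture, where the
  value is infinite. The lemma thus serves both to compute the marginal and to show that it diverges
  for singular \<open>J\<close>.\<close>

lemma nn_integral_pm_marg:
  assumes J: "J \<in> carrier_mat n n" "lower_tri J" and C: "C \<in> carrier_mat n m" and F: "F \<in> carrier_mat m n"
    and CF: "adjC J * C = adjC F" and y: "y \<in> carrier_vec m" and Es: "Es > 0"
  shows "(\<lambda>x. pm_cond F (adjC J * J) Es y (Matrix.vec n x) * cgauss_dens n Es x) \<in> borel_measurable (lebC n)"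
    and "(\<integral>\<^sup>+x. ennreal (pm_cond F (adjC J * J) Es y (Matrix.vec n x) * cgauss_dens n Es x) \<partial>lebC n)
    = ennreal (exp (sqnorm_vec (C *\<^sub>v y)) / (pi * Es) ^ n) *
      (\<Prod>i<n. if J $$ (i,i) = 0 then \<infinity> else ennreal (pi / (cmod (J $$ (i,i)))\<^sup>2))"
proof -
  note eq = pm_cond_mult_cgauss_dens[OF assms]
  let ?E = "\<lambda>i x. exp (- (cmod ((\<Sum>j\<le>i. J $$ (i,j) * x j) + - (C *\<^sub>v y) $ i))\<^sup>2)"
  let ?K = "exp (sqnorm_vec (C *\<^sub>v y)) / (pi * Es) ^ n"
  have meas: "(\<lambda>x. \<Prod>i<n. ?E i x) \<in> borel_measurable (lebC n)"
    by (rule measurable_gauss_triangular)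
  show "(\<lambda>x. pm_cond F (adjC J * J) Es y (Matrix.vec n x) * cgauss_dens n Es x) \<in> borel_measurable (lebC n)"
    unfolding eq by (intro borel_measurable_times borel_measurable_const meas)
  have "(\<integral>\<^sup>+x. ennreal (pm_cond F (adjC J * J) Es y (Matrix.vec n x) * cgauss_dens n Es x) \<partial>lebC n)
      = (\<integral>\<^sup>+x. ennreal ?K * ennreal (\<Prod>i<n. ?E i x) \<partial>lebC n)"
    unfolding eq using Es by (intro nn_integral_cong ennreal_mult prod_nonneg) auto
  also have "\<dots> = ennreal ?K * (\<integral>\<^sup>+x. ennreal (\<Prod>i<n. ?E i x) \<partial>lebC n)"
    by (intro nn_integral_cmult measurable_compose[OF meas measurable_ennreal])
  also have "(\<integral>\<^sup>+x. ennreal (\<Prod>i<n. ?E i x) \<partial>lebC n) = (\<integral>\<^sup>+x. (\<Prod>i<n. ennreal (?E i x)) \<partial>lebC n)"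
    by (intro nn_integral_cong) (simp add: prod_ennreal)
  finally show "(\<integral>\<^sup>+x. ennreal (pm_cond F (adjC J * J) Es y (Matrix.vec n x) * cgauss_dens n Es x) \<partial>lebC n)
    = ennreal ?K * (\<Prod>i<n. if J $$ (i,i) = 0 then \<infinity> else ennreal (pi / (cmod (J $$ (i,i)))\<^sup>2))"
    unfolding nn_integral_gauss_triangular .
qed

lemma pm_cond_mult_cgauss_dens_nonneg:
  "Es > 0 \<Longrightarrow> 0 \<le> pm_cond F G Es y v * cgauss_dens n Es x"
  by (simp add: pm_cond_def cgauss_dens_nonneg)

text \<open>For singular \<open>J\<close> the equation \<open>adjC J * C = adjC F\<close> may have
  no solution. At \<open>y = 0\<close>, however, \<open>F\<close> drops out of
  \<open>pm_cond\<close> and may be replaced by the zero matrix, for which \<open>C = 0\<close> is a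
  solution. The marginal integral at that point is then infinite, against integrability.\<close>

lemma I_LB_defined_imp_diag_nonzero:
  assumes J: "J \<in> carrier_mat n n" "lower_tri J" and F: "F \<in> carrier_mat m n" and H: "H \<in> carrier_mat m n"
    and Es: "Es > 0" and def: "I_LB_defined H Es N0 F (adjC J * J)" and i: "i < n"
  shows "J $$ (i,i) \<noteq> 0"
proof
  assume "J $$ (i,i) = 0"
  let ?y = "0\<^sub>v m :: complex Matrix.vec"
  have y: "?y \<in> carrier_vec m" by simp
  have zero: "pm_cond F (adjC J * J) Es ?y v = pm_cond (0\<^sub>m m n) (adjC J * J) Es ?y v"
    if v: "v \<in> carrier_vec n" for v
  proof -
    have "map_vec cnj ?y = ?y" by (rule eq_vecI) auto
    then show ?thesis
      using mult_mat_vec_carrier[OF F v] mult_mat_vec_carrier[OF zero_carrier_mat v, of m]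
      by (simp add: pm_cond_def)
  qed
  have "adjC J * 0\<^sub>m n m = adjC (0\<^sub>m m n)"
    using J by (intro eq_matI) auto
  note nn = nn_integral_pm_marg(2)[OF J _ _ this y Es]
  have "integrable (lebC n) (\<lambda>x. pm_cond F (adjC J * J) Es ?y (Matrix.vec n x) * cgauss_dens n Es x)"
    using def H y by (auto simp: I_LB_defined_def)
  then have "integrable (lebC n) (\<lambda>x. pm_cond (0\<^sub>m m n) (adjC J * J) Es ?y (Matrix.vec n x) * cgauss_dens n Es x)"
    by (simp add: zero)
  then have "(\<integral>\<^sup>+x. ennreal (pm_cond (0\<^sub>m m n) (adjC J * J) Es ?y (Matrix.vec n x) * cgauss_dens n Es x) \<partial>lebC n) < \<infinity>"
    using pm_cond_mult_cgauss_dens_nonneg[OF Es] by (simp add: integrable_iff_bounded)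
  moreover have "(\<Prod>i<n. if J $$ (i,i) = 0 then \<infinity> else ennreal (pi / (cmod (J $$ (i,i)))\<^sup>2)) = \<infinity>"
    unfolding infinity_ennreal_def using i \<open>J $$ (i,i) = 0\<close> by (subst ennreal_prod_eq_top) (auto simp: zero_less_power2 divide_le_0_iff)
  ultimately show False
    using Es by (subst (asm) nn) (auto simp: ennreal_mult_eq_top_iff ennreal_mult_less_top divide_le_0_iff)
qed

text \<open>All factors of the marginal are now finite and positive. The \<open>n\<close> factors
  \<open>pi\<close> from the Gaussian integrals cancel those of the prior density, so only
  \<open>Es\<close> and the diagonal of \<open>J\<close> survive in the logarithm.\<close>

lemma ln_pm_marg:
  assumes J: "J \<in> carrier_mat n n" "lower_tri J" and C: "C \<in> carrier_mat n m" and F: "F \<in> carrier_mat m n"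
    and CF: "adjC J * C = adjC F" and y: "y \<in> carrier_vec m" and Es: "Es > 0"
    and diag: "\<And>i. i < n \<Longrightarrow> J $$ (i,i) \<noteq> 0"
  shows "integrable (lebC n) (\<lambda>x. pm_cond F (adjC J * J) Es y (Matrix.vec n x) * cgauss_dens n Es x)"
    and "ln (pm_marg n F (adjC J * J) Es y)
      = sqnorm_vec (C *\<^sub>v y) - (real n * ln Es + (\<Sum>i<n. ln ((cmod (J $$ (i,i)))\<^sup>2)))"
proof -
  let ?K = "exp (sqnorm_vec (C *\<^sub>v y)) / (pi * Es) ^ n"
  let ?P = "\<Prod>i<n. pi / (cmod (J $$ (i,i)))\<^sup>2"
  note nn = nn_integral_pm_marg[OF J C F CF y Es]
  have KP: "?K > 0" "?P > 0"
    using Es diag by (auto intro!: prod_pos divide_pos_pos)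
  have "(\<Prod>i<n. if J $$ (i,i) = 0 then \<infinity> else ennreal (pi / (cmod (J $$ (i,i)))\<^sup>2)) = ennreal ?P"
    using diag by (subst prod_ennreal[symmetric]) (auto intro!: prod.cong)
  then have nn2: "(\<integral>\<^sup>+x. ennreal (pm_cond F (adjC J * J) Es y (Matrix.vec n x) * cgauss_dens n Es x) \<partial>lebC n)
      = ennreal (?K * ?P)"
    unfolding nn(2) using KP by (simp only:) (rule ennreal_mult[symmetric], simp_all only: less_imp_le)
  have hb: "has_bochner_integral (lebC n)
      (\<lambda>x. pm_cond F (adjC J * J) Es y (Matrix.vec n x) * cgauss_dens n Es x) (?K * ?P)"
  proof (rule has_bochner_integral_nn_integral[OF nn(1) _ _ nn2])
    show "AE x in lebC n. 0 \<le> pm_cond F (adjC J * J) Es y (Matrix.vec n x) * cgauss_dens n Es x"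
      by (intro AE_I2 pm_cond_mult_cgauss_dens_nonneg Es)
    show "0 \<le> ?K * ?P"
      using KP by (intro mult_nonneg_nonneg less_imp_le)
  qed
  then show "integrable (lebC n) (\<lambda>x. pm_cond F (adjC J * J) Es y (Matrix.vec n x) * cgauss_dens n Es x)"
    by (rule integrable.intros)
  have "pm_marg n F (adjC J * J) Es y = ?K * ?P"
    unfolding pm_marg_def using hb by (rule has_bochner_integral_integral_eq)
  then have "ln (pm_marg n F (adjC J * J) Es y) = ln ?K + ln ?P"
    using KP by (simp only: ln_mult_pos)
  also have "ln ?P = (\<Sum>i<n. ln (pi / (cmod (J $$ (i,i)))\<^sup>2))"
    using diag by (intro ln_prod) auto
  also have "\<dots> = real n * ln pi - (\<Sum>i<n. ln ((cmod (J $$ (i,i)))\<^sup>2))"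
    using diag by (simp add: ln_div sum_subtractf)
  also have "ln ?K = sqnorm_vec (C *\<^sub>v y) - real n * (ln pi + ln Es)"
    using Es by (simp add: ln_div ln_realpow ln_mult_pos)
  finally show "ln (pm_marg n F (adjC J * J) Es y)
      = sqnorm_vec (C *\<^sub>v y) - (real n * ln Es + (\<Sum>i<n. ln ((cmod (J $$ (i,i)))\<^sup>2)))"
    by (simp add: algebra_simps)
qed

lemma has_bochner_integral_joint_xz_sqnorm:
  assumes "Es > 0" "N0 > 0" and A: "A \<in> carrier_mat k n" and B: "B \<in> carrier_mat k m"
  shows "has_bochner_integral (joint_xz m n Es N0)
    (\<lambda>p. sqnorm_vec (A *\<^sub>v Matrix.vec n (fst p) + B *\<^sub>v Matrix.vec m (snd p)))
    (Es * frob A + N0 * frob B)"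
proof -
  have "has_bochner_integral (joint_xz m n Es N0)
    (\<lambda>p. \<Sum>i<k. (cmod ((\<Sum>j<n. A $$ (i,j) * fst p j) + (\<Sum>j<m. B $$ (i,j) * snd p j)))\<^sup>2)
    (\<Sum>i<k. Es * (\<Sum>j<n. (cmod (A $$ (i,j)))\<^sup>2) + N0 * (\<Sum>j<m. (cmod (B $$ (i,j)))\<^sup>2))"
    by (intro has_bochner_integral_sum has_bochner_integral_joint_xz_sq assms)
  then show ?thesis
    using A B by (simp add: sqnorm_vec_def frob_def scalar_prod_def atLeast0LessThan
        sum.distrib sum_distrib_left)
qed

lemma frob_one: "frob (1\<^sub>m n) = real n"
proof -
  have "(\<Sum>j<n. (cmod (1\<^sub>m n $$ (i,j)))\<^sup>2) = 1" if "i < n" for i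
    using that by (subst sum.mono_neutral_right[of _ "{i}"]) auto
  then show ?thesis by (simp add: frob_def)
qed

lemma frob_zero: "frob (0\<^sub>m n m) = 0"
  by (simp add: frob_def)

lemma frob_uminus: "frob (- A) = frob A"
  by (simp add: frob_def)

text \<open>Both logarithms contain the squared norm of \<open>C y\<close>, which cancels. What is
  left is the mean of \<open>sqnorm_vec x / Es\<close>, which is \<open>n\<close>, the constant from
  the marginal, and the mean squared error of \<open>J x - C y\<close>. Substituting
  \<open>y = H x + z\<close> turns this error into a linear form in the independent signal and
  noise, whose mean square is read off from the coefficients.\<close>

lemma I_LB_eq:
  assumes J: "J \<in> carrier_mat n n" "lower_tri J" and C: "C \<in> carrier_mat n m" and F: "F \<in> carrier_mat m n"
    and CF: "adjC J * C = adjC F" and H: "H \<in> carrier_mat m n" and Es: "Es > 0" and N0: "N0 > 0"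
    and diag: "\<And>i. i < n \<Longrightarrow> J $$ (i,i) \<noteq> 0"
  shows "I_LB_defined H Es N0 F (adjC J * J)"
    and "I_LB H Es N0 F (adjC J * J) = real n + real n * ln Es + (\<Sum>i<n. ln ((cmod (J $$ (i,i)))\<^sup>2))
      - (Es * frob (J - C * H) + N0 * frob C)"
proof -
  let ?M = "joint_xz m n Es N0"
  let ?x = "\<lambda>p. Matrix.vec n (fst p) :: complex Matrix.vec"
  let ?z = "\<lambda>p. Matrix.vec m (snd p) :: complex Matrix.vec"
  let ?y = "\<lambda>p. rx H (fst p) (snd p)"
  let ?\<kappa> = "real n * ln Es + (\<Sum>i<n. ln ((cmod (J $$ (i,i)))\<^sup>2))"
  interpret prob_space ?M by (rule prob_space_joint_xz[OF Es N0])
  have y_eq: "?y p = H *\<^sub>v ?x p + ?z p" for p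
    using H by (simp add: rx_def)
  have y: "?y p \<in> carrier_vec m" for p
    using H by (simp add: y_eq)
  have Cy: "C *\<^sub>v ?y p = (C * H) *\<^sub>v ?x p + C *\<^sub>v ?z p" for p
    unfolding y_eq using H C by (subst mult_add_distrib_mat_vec[of _ n m]) auto
  have Jy: "J *\<^sub>v ?x p - C *\<^sub>v ?y p = (J - C * H) *\<^sub>v ?x p + (- C) *\<^sub>v ?z p" for p
  proof -
    have "(J - C * H) *\<^sub>v ?x p = J *\<^sub>v ?x p - (C * H) *\<^sub>v ?x p"
      using J C H by (intro minus_mult_distrib_mat_vec) auto
    moreover have "(- C) *\<^sub>v ?z p = - (C *\<^sub>v ?z p)"
      using C by (intro uminus_mult_mat_vec) auto
    ultimately show ?thesis
      unfolding Cy using J C H by (intro eq_vecI) (auto simp del: index_mult_mat_vec)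
  qed
  \<comment> \<open>The signal alone is put in the shape \<open>A x + B z\<close>, with
    \<open>A\<close> the identity and \<open>B\<close> zero, so that the general mean square
    applies.\<close>
  have x_eq: "?x p = 1\<^sub>m n *\<^sub>v ?x p + 0\<^sub>m n m *\<^sub>v ?z p" for p
    by (intro eq_vecI) auto
  have "has_bochner_integral ?M (\<lambda>p. sqnorm_vec (?x p)) (Es * real n)"
    by (subst x_eq, subst frob_one[symmetric])
      (use has_bochner_integral_joint_xz_sqnorm[OF Es N0, of "1\<^sub>m n" n n "0\<^sub>m n m" m] in \<open>simp add: frob_zero\<close>)
  then have X: "has_bochner_integral ?M (\<lambda>p. sqnorm_vec (?x p) / Es) (real n)"
    using has_bochner_integral_divide_zero[of Es ?M _ "Es * real n"] Es by simp
  \<comment> \<open>Only the existence of this mean matters: \<open>q\<close> enters both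
    expectations and disappears from their difference.\<close>
  obtain q where Y: "has_bochner_integral ?M (\<lambda>p. sqnorm_vec (C *\<^sub>v ?y p)) q"
    unfolding Cy using has_bochner_integral_joint_xz_sqnorm[OF Es N0, of "C * H" n n C m] C H by auto
  have Z: "has_bochner_integral ?M (\<lambda>p. sqnorm_vec (J *\<^sub>v ?x p - C *\<^sub>v ?y p)) (Es * frob (J - C * H) + N0 * frob C)"
  proof -
    have "J - C * H \<in> carrier_mat n n" "- C \<in> carrier_mat n m" using J C H by auto
    from has_bochner_integral_joint_xz_sqnorm[OF Es N0 this] show ?thesis
      unfolding Jy frob_uminus .
  qed
  have K: "has_bochner_integral ?M (\<lambda>p. ?\<kappa>) ?\<kappa>"
    by (simp add: has_bochner_integral_iff prob_space)
  have 1: "has_bochner_integral ?M (\<lambda>p. ln (pm_cond F (adjC J * J) Es (?y p) (?x p)))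
      (real n + q - (Es * frob (J - C * H) + N0 * frob C))"
    using has_bochner_integral_diff[OF has_bochner_integral_add[OF X Y] Z] y
    by (simp add: ln_pm_cond[OF J(1) C F CF])
  have 2: "has_bochner_integral ?M (\<lambda>p. ln (pm_marg n F (adjC J * J) Es (?y p))) (q - ?\<kappa>)"
    using has_bochner_integral_diff[OF Y K] y
    by (simp add: ln_pm_marg(2)[OF J C F CF _ Es diag])
  have dims: "dim_row H = m" "dim_col H = n"
    using H by auto
  show "I_LB_defined H Es N0 F (adjC J * J)"
    unfolding I_LB_defined_def dims
  proof (intro conjI allI impI)
    fix y :: "complex Matrix.vec" assume "dim_vec y = m"
    then have "y \<in> carrier_vec m" by (rule carrier_vecI)
    then show "integrable (lebC n) (\<lambda>x. pm_cond F (adjC J * J) Es y (Matrix.vec n x) * cgauss_dens n Es x)"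
      by (rule ln_pm_marg(1)[OF J C F CF _ Es diag])
  qed (rule integrable.intros[OF 1], rule integrable.intros[OF 2])
  have "I_LB H Es N0 F (adjC J * J) = real n + ?\<kappa> - (Es * frob (J - C * H) + N0 * frob C)"
    unfolding I_LB_def dims has_bochner_integral_integral_eq[OF 1] has_bochner_integral_integral_eq[OF 2] by simp
  then show "I_LB H Es N0 F (adjC J * J) = real n + real n * ln Es + (\<Sum>i<n. ln ((cmod (J $$ (i,i)))\<^sup>2))
      - (Es * frob (J - C * H) + N0 * frob C)"
    by simp
qed

subsection \<open>The augmented channel\<close>

lemma sum_lessThan_add:
  fixes f :: "nat \<Rightarrow> 'a::comm_monoid_add"
  shows "(\<Sum>k<m + n. f k) = (\<Sum>k<m. f k) + (\<Sum>k<n. f (m + k))"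
  by (induction n) (auto simp: add.assoc)

lemma mult_index_sum:
  "A \<in> carrier_mat n m \<Longrightarrow> B \<in> carrier_mat m k \<Longrightarrow> i < n \<Longrightarrow> j < k \<Longrightarrow>
    (A * B) $$ (i,j) = (\<Sum>l<m. A $$ (i,l) * B $$ (l,j))"
  by (auto simp: scalar_prod_def atLeast0LessThan)

text \<open>Trades the block witnesses for conditions on entries, which are easier to check for
  products. In the converse direction the blocks are recovered by \<open>blk\<close>.\<close>

lemma punctured_iff:
  assumes "nu \<le> n"
  shows "punctured nu n J \<longleftrightarrow> J \<in> carrier_mat n n \<and> lower_tri J \<and>
    (\<forall>i<n. \<forall>j<n. nu \<le> i \<longrightarrow> nu \<le> j \<longrightarrow> i \<noteq> j \<longrightarrow> J $$ (i,j) = 0) \<and>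
    (\<forall>i<n. nu \<le> i \<longrightarrow> J $$ (i,i) \<in> \<real>)"
    (is "?l \<longleftrightarrow> ?r")
proof
  assume ?l
  then obtain J1 J2 J3 where *: "J1 \<in> carrier_mat nu nu" "lower_tri J1" "J2 \<in> carrier_mat (n - nu) nu"
    "J3 \<in> carrier_mat (n - nu) (n - nu)" "diagonal_mat J3" "\<forall>i < n - nu. J3 $$ (i,i) \<in> \<real>"
    "J = four_block_mat J1 (0\<^sub>m nu (n - nu)) J2 J3"
    unfolding punctured_def by blast
  have J: "J \<in> carrier_mat n n"
    unfolding *(7) using *(1,4) assms by auto
  have ix: "J $$ (i,j) = (if i < nu then if j < nu then J1 $$ (i,j) else 0
      else if j < nu then J2 $$ (i - nu,j) else J3 $$ (i - nu,j - nu))" if "i < n" "j < n" for i j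
    unfolding *(7) using *(1,3,4) that by simp
  have "lower_tri J"
    unfolding lower_tri_def
  proof (intro allI impI)
    fix i j assume ij: "i < dim_row J" "j < dim_col J" "i < j"
    then have "i < n" "j < n" using J by auto
    with ij(3) *(1,2,4,5) show "J $$ (i,j) = 0"
      by (simp add: ix lower_tri_def diagonal_mat_def)
  qed
  moreover have "J $$ (i,j) = 0" if "i < n" "j < n" "nu \<le> i" "nu \<le> j" "i \<noteq> j" for i j
    using that *(4,5) by (simp add: ix diagonal_mat_def)
  moreover have "J $$ (i,i) \<in> \<real>" if "i < n" "nu \<le> i" for i
    using that *(6) by (simp add: ix)
  ultimately show ?r using J by blast
next
  assume r: ?r
  let ?k = "n - nu"
  have "J = four_block_mat (blk J 0 0 nu nu) (0\<^sub>m nu ?k) (blk J nu 0 ?k nu) (blk J nu nu ?k ?k)"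
    using r assms by (intro eq_matI) (auto simp: blk_def lower_tri_def)
  then show ?l
    unfolding punctured_def using r assms
    by (intro exI[of _ "blk J 0 0 nu nu"] exI[of _ "blk J nu 0 ?k nu"] exI[of _ "blk J nu nu ?k ?k"])
       (auto simp: blk_def lower_tri_def diagonal_mat_def)
qed

text \<open>This is the matrix \<open>U\<close> of the overview. Up to the sign of its first block
  it expresses the error \<open>A x - C y\<close> in signal and noise rescaled to unit variance. The
  target \<open>A\<close> is left free, since \<open>J\<close>, the triangular QL factor, its Gram
  matrix and \<open>L_ap\<close> all take its place below.\<close>

definition aug_filter :: "complex mat \<Rightarrow> real \<Rightarrow> real \<Rightarrow> complex mat \<Rightarrow> complex mat \<Rightarrow> complex mat" where
  "aug_filter H Es N0 A C = mat (dim_row A) (dim_row H + dim_col H)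
    (\<lambda>(i,j). if j < dim_row H then complex_of_real (sqrt N0) * C $$ (i,j)
      else complex_of_real (sqrt Es) * (A - C * H) $$ (i, j - dim_row H))"

lemma H_aug_carrier: "H \<in> carrier_mat m n \<Longrightarrow> H_aug H Es N0 \<in> carrier_mat (m + n) n"
  by (auto simp: H_aug_def)

lemma H_aug_index:
  assumes "H \<in> carrier_mat m n" "j < n"
  shows "i < m \<Longrightarrow> H_aug H Es N0 $$ (i,j) = H $$ (i,j) / complex_of_real (sqrt N0)"
    and "i < n \<Longrightarrow> H_aug H Es N0 $$ (m + i,j) = (if i = j then 1 / complex_of_real (sqrt Es) else 0)"
  using assms by (auto simp: H_aug_def)

context
  fixes H :: "complex mat" and m n :: nat and Es N0 :: real
  assumes H: "H \<in> carrier_mat m n" and Es: "Es > 0" and N0: "N0 > 0"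
begin

lemma aug_filter_carrier: "A \<in> carrier_mat k n \<Longrightarrow> aug_filter H Es N0 A C \<in> carrier_mat k (m + n)"
  using H by (auto simp: aug_filter_def)

lemma aug_filter_index:
  assumes "A \<in> carrier_mat k n" "i < k"
  shows "j < m \<Longrightarrow> aug_filter H Es N0 A C $$ (i,j) = complex_of_real (sqrt N0) * C $$ (i,j)"
    and "j < n \<Longrightarrow> aug_filter H Es N0 A C $$ (i,m + j) = complex_of_real (sqrt Es) * (A - C * H) $$ (i,j)"
  using assms H by (auto simp: aug_filter_def)

text \<open>The scalings cancel: the noise block yields \<open>C * H\<close> and the signal block
  supplies the difference \<open>A - C * H\<close>. The product is therefore independent of the
  choice of \<open>C\<close>.\<close>

lemma aug_filter_mult_H_aug:
  assumes A: "A \<in> carrier_mat k n" and C: "C \<in> carrier_mat k m"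
  shows "aug_filter H Es N0 A C * H_aug H Es N0 = A"
proof (rule eq_matI)
  fix i j assume "i < dim_row A" "j < dim_col A"
  then have ij: "i < k" "j < n" using A by auto
  let ?U = "aug_filter H Es N0 A C"
  have "(?U * H_aug H Es N0) $$ (i,j) = (\<Sum>l<m + n. ?U $$ (i,l) * H_aug H Es N0 $$ (l,j))"
    by (rule mult_index_sum[OF aug_filter_carrier[OF A] H_aug_carrier[OF H] ij])
  also have "\<dots> = (\<Sum>l<m. ?U $$ (i,l) * H_aug H Es N0 $$ (l,j)) + (\<Sum>l<n. ?U $$ (i,m + l) * H_aug H Es N0 $$ (m + l,j))"
    by (rule sum_lessThan_add)
  also have "(\<Sum>l<m. ?U $$ (i,l) * H_aug H Es N0 $$ (l,j)) = (C * H) $$ (i,j)"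
    using N0 ij by (simp add: mult_index_sum[OF C H] aug_filter_index[OF A] H_aug_index[OF H])
  also have "(\<Sum>l<n. ?U $$ (i,m + l) * H_aug H Es N0 $$ (m + l,j)) = (\<Sum>l<n. if l = j then (A - C * H) $$ (i,j) else 0)"
    using Es ij by (intro sum.cong) (auto simp: aug_filter_index[OF A] H_aug_index[OF H])
  finally show "(?U * H_aug H Es N0) $$ (i,j) = A $$ (i,j)"
    using ij A C H by simp
qed (use A H in \<open>auto simp: aug_filter_def H_aug_def\<close>)

lemma frob_aug_filter:
  assumes A: "A \<in> carrier_mat k n" and C: "C \<in> carrier_mat k m"
  shows "frob (aug_filter H Es N0 A C) = Es * frob (A - C * H) + N0 * frob C"
proof -
  have "frob (aug_filter H Es N0 A C)
      = (\<Sum>i<k. \<Sum>j<m + n. (cmod (aug_filter H Es N0 A C $$ (i,j)))\<^sup>2)"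
    using aug_filter_carrier[OF A, of C] by (simp add: frob_def)
  also have "\<dots> = (\<Sum>i<k. N0 * (\<Sum>j<m. (cmod (C $$ (i,j)))\<^sup>2) + Es * (\<Sum>j<n. (cmod ((A - C * H) $$ (i,j)))\<^sup>2))"
    unfolding sum_lessThan_add sum_distrib_left using Es N0
    by (intro sum.cong arg_cong2[of _ _ _ _ "(+)"])
       (auto simp: aug_filter_index[OF A] norm_mult power_mult_distrib simp del: index_minus_mat index_mult_mat)
  also have "\<dots> = Es * frob (A - C * H) + N0 * frob C"
  proof -
    have "A - C * H \<in> carrier_mat k n" using A C H by auto
    then show ?thesis
      using C by (simp add: frob_def sum.distrib sum_distrib_left del: index_minus_mat index_mult_mat)
  qed
  finally show ?thesis .
qed

text \<open>The construction is linear on the left, so a filter found for one target carries over to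
  all its left multiples, in particular from the QL factor to \<open>L_ap\<close>.\<close>

lemma mult_aug_filter:
  assumes V: "V \<in> carrier_mat l k" and A: "A \<in> carrier_mat k n" and C: "C \<in> carrier_mat k m"
  shows "V * aug_filter H Es N0 A C = aug_filter H Es N0 (V * A) (V * C)"
proof (rule eq_matI)
  fix i j assume "i < dim_row (aug_filter H Es N0 (V * A) (V * C))" "j < dim_col (aug_filter H Es N0 (V * A) (V * C))"
  then have ij: "i < l" "j < m + n" using V H by (auto simp: aug_filter_def)
  have VA: "V * A \<in> carrier_mat l n" using V A by auto
  have D: "A - C * H \<in> carrier_mat k n" using A C H by auto
  have eq: "V * A - V * C * H = V * (A - C * H)"
    using assoc_mult_mat[OF V C H] mult_minus_distrib_mat[OF V A, of "C * H"] C H by simp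
  have "(V * aug_filter H Es N0 A C) $$ (i,j) = (\<Sum>p<k. V $$ (i,p) * aug_filter H Es N0 A C $$ (p,j))"
    by (rule mult_index_sum[OF V aug_filter_carrier[OF A] ij])
  also have "\<dots> = aug_filter H Es N0 (V * A) (V * C) $$ (i,j)"
  proof (cases "j < m")
    case True
    then show ?thesis
      using ij by (simp add: aug_filter_index[OF VA] aug_filter_index[OF A] mult_index_sum[OF V C]
          sum_distrib_left mult_ac)
  next
    case False
    then obtain j' where j': "j = m + j'" "j' < n"
      using ij by (metis add_diff_inverse_nat nat_add_left_cancel_less)
    have "(V * (A - C * H)) $$ (i,j') = (\<Sum>p<k. V $$ (i,p) * (A - C * H) $$ (p,j'))"
      by (rule mult_index_sum[OF V D ij(1) j'(2)])
    then show ?thesis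
      using ij j' unfolding j' by (simp add: aug_filter_index[OF VA] aug_filter_index[OF A] eq
          sum_distrib_left mult_ac del: index_minus_mat index_mult_mat)
  qed
  finally show "(V * aug_filter H Es N0 A C) $$ (i,j) = aug_filter H Es N0 (V * A) (V * C) $$ (i,j)" .
qed (use V H in \<open>auto simp: aug_filter_def\<close>)

text \<open>The link between QL decomposition and MMSE: the right side is the matrix inverted in
  \<open>W_MMSE\<close>, and the left side depends only on the triangular factor, since
  \<open>Q\<close> drops out of the Gram matrix.\<close>

lemma H_aug_gram:
  "complex_of_real N0 \<cdot>\<^sub>m (adjC (H_aug H Es N0) * H_aug H Es N0)
    = adjC H * H + complex_of_real (N0 / Es) \<cdot>\<^sub>m 1\<^sub>m n"
proof (rule eq_matI)
  let ?A = "H_aug H Es N0"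
  note Ac = H_aug_carrier[OF H, of Es N0]
  fix i j assume "i < dim_row (adjC H * H + complex_of_real (N0 / Es) \<cdot>\<^sub>m 1\<^sub>m n)"
    "j < dim_col (adjC H * H + complex_of_real (N0 / Es) \<cdot>\<^sub>m 1\<^sub>m n)"
  then have ij: "i < n" "j < n" using H by auto
  have sq: "complex_of_real (sqrt r) * complex_of_real (sqrt r) = complex_of_real r" if "r > 0" for r
    using that by (simp flip: of_real_mult)
  have "(adjC ?A * ?A) $$ (i,j) = (\<Sum>l<m + n. adjC ?A $$ (i,l) * ?A $$ (l,j))"
    by (rule mult_index_sum[OF adjC_carrier[OF Ac] Ac ij])
  also have "\<dots> = (\<Sum>l<m. adjC ?A $$ (i,l) * ?A $$ (l,j)) + (\<Sum>l<n. adjC ?A $$ (i,m + l) * ?A $$ (m + l,j))"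
    by (rule sum_lessThan_add)
  also have "(\<Sum>l<m. adjC ?A $$ (i,l) * ?A $$ (l,j)) = (\<Sum>l<m. adjC H $$ (i,l) * H $$ (l,j) / complex_of_real N0)"
    using ij H Ac N0 by (intro sum.cong) (auto simp: H_aug_index[OF H] sq)
  also have "\<dots> = (adjC H * H) $$ (i,j) / complex_of_real N0"
    by (simp add: mult_index_sum[OF adjC_carrier[OF H] H ij] sum_divide_distrib)
  also have "(\<Sum>l<n. adjC ?A $$ (i,m + l) * ?A $$ (m + l,j))
      = (\<Sum>l<n. if l = j then (if i = j then 1 / complex_of_real Es else 0) else 0)"
    using ij H Ac Es by (intro sum.cong) (auto simp: H_aug_index[OF H] sq)
  also have "\<dots> = (if i = j then 1 / complex_of_real Es else 0)"
    using ij by simp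
  finally have "complex_of_real N0 * (adjC ?A * ?A) $$ (i,j) = (adjC H * H) $$ (i,j) + (if i = j then complex_of_real (N0 / Es) else 0)"
    using N0 by (simp add: field_simps)
  then show "(complex_of_real N0 \<cdot>\<^sub>m (adjC ?A * ?A)) $$ (i,j)
      = (adjC H * H + complex_of_real (N0 / Es) \<cdot>\<^sub>m 1\<^sub>m n) $$ (i,j)"
    using ij H Ac by (simp del: index_mult_mat(1))
qed (use H H_aug_carrier[OF H, of Es N0] in auto)

text \<open>With \<open>B = adjC L * L\<close> the matrix inverted in \<open>W\<close> is
  \<open>N0\<close> times \<open>B\<close>. Hence \<open>N0\<close> times \<open>B * W\<close> is
  \<open>adjC H\<close>, and \<open>N0\<close> times \<open>B - B * W * H\<close> is the
  regularising term \<open>N0 / Es\<close> times the identity. These are the two blocks of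
  \<open>adjC (H_aug H Es N0)\<close>, which equals \<open>adjC L * adjC Q\<close>; cancelling
  \<open>adjC L\<close> finishes. The MMSE filter thus leaves no component outside the span of the
  rows of \<open>adjC Q\<close>, which makes Bessel's inequality tight.\<close>

lemma aug_filter_W_MMSE:
  assumes Q: "Q \<in> carrier_mat (m + n) n" and L: "L \<in> carrier_mat n n" and QQ: "adjC Q * Q = 1\<^sub>m n"
    and A: "H_aug H Es N0 = Q * L" and lt: "lower_tri L" and diag: "\<And>i. i < n \<Longrightarrow> L $$ (i,i) \<noteq> 0"
  shows "W_MMSE H Es N0 \<in> carrier_mat n m"
    and "aug_filter H Es N0 L (L * W_MMSE H Es N0) = adjC Q"
proof -
  define B where "B = adjC L * L"
  define W where "W = W_MMSE H Es N0"
  define M where "M = adjC H * H + complex_of_real (N0 / Es) \<cdot>\<^sub>m 1\<^sub>m n"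
  have B: "B \<in> carrier_mat n n" and M: "M \<in> carrier_mat n n"
    using L H by (auto simp: B_def M_def)
  have detL: "det L \<noteq> 0" "det (adjC L) \<noteq> 0"
    using diag by (auto simp: det_adjC[OF L lt] det_lower_tri[OF L lt])
  have "adjC (Q * L) * (Q * L) = B"
  proof -
    have "adjC (Q * L) * (Q * L) = adjC L * (adjC Q * (Q * L))"
      unfolding adjC_mult[OF Q L] using Q L by (intro assoc_mult_mat) auto
    also have "adjC Q * (Q * L) = L"
      using assoc_mult_mat[OF adjC_carrier[OF Q] Q L] L QQ by simp
    finally show ?thesis by (simp add: B_def)
  qed
  then have MB: "M = complex_of_real N0 \<cdot>\<^sub>m B"
    using H_aug_gram by (simp add: M_def A)
  have "det M \<noteq> 0"
    unfolding MB det_smult using B N0 detL by (simp add: B_def det_mult[OF adjC_carrier[OF L] L])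
  note invM = invC[OF M this]
  have W_eq: "W = invC M * adjC H"
    using H by (simp add: W_def W_MMSE_def M_def)
  show W: "W_MMSE H Es N0 \<in> carrier_mat n m"
    using invM H W_eq by (auto simp: W_def)
  then have W': "W \<in> carrier_mat n m" by (simp add: W_def)
  have MW: "M * W = adjC H"
    unfolding W_eq using assoc_mult_mat[OF M invM(1) adjC_carrier[OF H]] invM H by simp
  have BW: "complex_of_real N0 \<cdot>\<^sub>m (B * W) = adjC H"
    using MW unfolding MB by (simp add: mult_smult_assoc_mat[OF B W'])
  have LW: "L * W \<in> carrier_mat n m" using L W' by auto
  have BWH: "complex_of_real N0 \<cdot>\<^sub>m (B - B * W * H) = complex_of_real (N0 / Es) \<cdot>\<^sub>m 1\<^sub>m n"
  proof -
    define X where "X = B * W * H"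
    have X: "X \<in> carrier_mat n n" using B W' H by (simp add: X_def)
    have "complex_of_real N0 \<cdot>\<^sub>m X = adjC H * H" unfolding X_def
      using mult_smult_assoc_mat[of "B * W" n m H n "complex_of_real N0"] B W' H BW by simp
    then have 1: "complex_of_real N0 * X $$ (i,j) = (adjC H * H) $$ (i,j)" if "i < n" "j < n" for i j
      using that X by (metis carrier_matD index_smult_mat(1))
    have 2: "complex_of_real N0 * B $$ (i,j) = (adjC H * H) $$ (i,j) + (if i = j then complex_of_real (N0 / Es) else 0)"
      if "i < n" "j < n" for i j
    proof -
      have "M $$ (i,j) = complex_of_real N0 * B $$ (i,j)"
        unfolding MB using that B by simp
      then show ?thesis
        unfolding M_def using that H by (cases "i = j") (simp_all del: index_mult_mat(1))
    qed
    show ?thesis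
      unfolding X_def[symmetric]
      using B X by (intro eq_matI) (simp_all add: right_diff_distrib 1 2 del: index_mult_mat(1))
  qed
  define U where "U = aug_filter H Es N0 L (L * W)"
  have U: "U \<in> carrier_mat n (m + n)"
    unfolding U_def by (rule aug_filter_carrier[OF L])
  have "adjC L * U = aug_filter H Es N0 B (B * W)"
    unfolding U_def mult_aug_filter[OF adjC_carrier[OF L] L LW] B_def
    using assoc_mult_mat[OF adjC_carrier[OF L] L W'] by simp
  also have "\<dots> = adjC (H_aug H Es N0)"
  proof (rule eq_matI)
    note Ac = H_aug_carrier[OF H, of Es N0]
    have sq: "complex_of_real (sqrt r) * complex_of_real (sqrt r) = complex_of_real r" if "r > 0" for r
      using that by (simp flip: of_real_mult)
    fix i j assume "i < dim_row (adjC (H_aug H Es N0))" "j < dim_col (adjC (H_aug H Es N0))"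
    then have ij: "i < n" "j < m + n" using Ac by auto
    show "aug_filter H Es N0 B (B * W) $$ (i,j) = adjC (H_aug H Es N0) $$ (i,j)"
    proof (cases "j < m")
      case True
      have "complex_of_real N0 * (B * W) $$ (i,j) = cnj (H $$ (j,i))"
        using arg_cong[OF BW, of "\<lambda>X. X $$ (i,j)"] True ij B W' H by (simp del: index_mult_mat(1))
      then have "complex_of_real (sqrt N0) * (complex_of_real (sqrt N0) * (B * W) $$ (i,j)) = cnj (H $$ (j,i))"
        using sq[OF N0] by (simp flip: mult.assoc del: index_mult_mat(1))
      then have "complex_of_real (sqrt N0) * (B * W) $$ (i,j) = cnj (H $$ (j,i)) / complex_of_real (sqrt N0)"
        using N0 by (simp add: field_simps del: index_mult_mat(1))
      then show ?thesis
        using True ij Ac by (simp add: aug_filter_index[OF B] H_aug_index[OF H] del: index_mult_mat(1))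
    next
      case False
      then obtain j' where j': "j = m + j'" "j' < n"
        using ij by (metis add_diff_inverse_nat nat_add_left_cancel_less)
      have "complex_of_real N0 * (B - B * W * H) $$ (i,j') = (if i = j' then complex_of_real (N0 / Es) else 0)"
        using arg_cong[OF BWH, of "\<lambda>X. X $$ (i,j')"] j' ij B W' H by (simp del: index_mult_mat(1) index_minus_mat(1))
      then have "(B - B * W * H) $$ (i,j') = (if i = j' then complex_of_real (N0 / Es) else 0) / complex_of_real N0"
        using N0 by (intro nonzero_eq_divide_eq[THEN iffD2]) (simp_all only: mult.commute, simp)
      then have "(B - B * W * H) $$ (i,j') = (if i = j' then 1 / (complex_of_real (sqrt Es) * complex_of_real (sqrt Es)) else 0)"
        unfolding sq[OF Es] using N0 by (simp del: index_mult_mat(1) index_minus_mat(1))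
      then have "complex_of_real (sqrt Es) * (B - B * W * H) $$ (i,j') = (if i = j' then 1 / complex_of_real (sqrt Es) else 0)"
        using Es by simp
      then show ?thesis
        using j' ij Ac by (simp add: aug_filter_index[OF B] H_aug_index[OF H] del: index_mult_mat(1) index_minus_mat(1))
    qed
  qed (use aug_filter_carrier[OF B, of "B * W"] H_aug_carrier[OF H, of Es N0] in auto)
  also have "\<dots> = adjC L * adjC Q"
    unfolding A by (rule adjC_mult[OF Q L])
  finally show "aug_filter H Es N0 L (L * W_MMSE H Es N0) = adjC Q"
    unfolding W_def[symmetric] U_def[symmetric]
    by (rule mat_cancel_left[OF adjC_carrier[OF L] detL(2) U adjC_carrier[OF Q]])
qed

end

subsection \<open>Punctured matrices\<close>

text \<open>Back substitution, starting from the last column. In entry \<open>(i,j)\<close> of the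
  product, terms with \<open>l < j\<close> vanish because \<open>L\<close> is triangular, and those
  with \<open>l > j\<close> by induction, so \<open>T $$ (i,j)\<close> times a nonzero diagonal
  entry is 0.\<close>

lemma lower_tri_mult_right_cancel:
  fixes T L :: "complex mat"
  assumes T: "T \<in> carrier_mat n n" and L: "L \<in> carrier_mat n n" and lt: "lower_tri L" "lower_tri (T * L)"
    and diag: "\<And>i. i < n \<Longrightarrow> L $$ (i,i) \<noteq> 0"
  shows "lower_tri T"
proof -
  have "T $$ (i,j) = 0" if "i < j" "j < n" for i j
    using that
  proof (induction "n - j" arbitrary: j rule: less_induct)
    case less
    have "0 = (T * L) $$ (i,j)"
      using lt less.prems T L by (auto simp: lower_tri_def)
    also have "\<dots> = (\<Sum>l<n. T $$ (i,l) * L $$ (l,j))"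
      using less.prems by (intro mult_index_sum[OF T L]) auto
    also have "\<dots> = (\<Sum>l<n. if l = j then T $$ (i,j) * L $$ (j,j) else 0)"
    proof (rule sum.cong[OF refl])
      fix l assume "l \<in> {..<n}"
      then have l: "l < n" by simp
      consider "l < j" | "l = j" | "j < l" by linarith
      then show "T $$ (i,l) * L $$ (l,j) = (if l = j then T $$ (i,j) * L $$ (j,j) else 0)"
      proof cases
        case 1
        then show ?thesis using lt(1) L less.prems by (auto simp: lower_tri_def)
      next
        case 3
        then have "T $$ (i,l) = 0" using less l by auto
        then show ?thesis using 3 by simp
      qed simp
    qed
    also have "\<dots> = T $$ (i,j) * L $$ (j,j)"
      using less.prems by simp
    finally show ?case using diag less.prems by simp
  qed
  then show ?thesis using T by (auto simp: lower_tri_def)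
qed

lemma diag_mult_lower_tri:
  fixes T L :: "complex mat"
  assumes T: "T \<in> carrier_mat n n" and L: "L \<in> carrier_mat n n" and lt: "lower_tri T" "lower_tri L" and i: "i < n"
  shows "(T * L) $$ (i,i) = T $$ (i,i) * L $$ (i,i)"
proof -
  have "(T * L) $$ (i,i) = (\<Sum>l<n. T $$ (i,l) * L $$ (l,i))"
    by (rule mult_index_sum[OF T L i i])
  also have "\<dots> = (\<Sum>l<n. if l = i then T $$ (i,i) * L $$ (i,i) else 0)"
  proof (rule sum.cong[OF refl])
    fix l assume "l \<in> {..<n}"
    then show "T $$ (i,l) * L $$ (l,i) = (if l = i then T $$ (i,i) * L $$ (i,i) else 0)"
      using lt T L i by (cases l i rule: linorder_cases) (auto simp: lower_tri_def)
  qed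
  finally show ?thesis using i by simp
qed

lemma lower_tri_mult:
  fixes A B :: "complex mat"
  assumes A: "A \<in> carrier_mat n n" and B: "B \<in> carrier_mat n n" and lt: "lower_tri A" "lower_tri B"
  shows "lower_tri (A * B)"
proof -
  have "(A * B) $$ (i,j) = 0" if "i < j" "j < n" for i j
  proof -
    have "A $$ (i,l) * B $$ (l,j) = 0" if "l < n" for l
      using A B lt that \<open>i < j\<close> \<open>j < n\<close> by (cases "i < l") (auto simp: lower_tri_def)
    then have "(\<Sum>l<n. A $$ (i,l) * B $$ (l,j)) = 0"
      by (intro sum.neutral) auto
    then show ?thesis
      using mult_index_sum[OF A B, of i j] that by simp
  qed
  then show ?thesis using A B by (auto simp: lower_tri_def simp del: index_mult_mat(1))
qed

text \<open>The columns of \<open>L\<close> from \<open>nu\<close> on are zero above row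
  \<open>nu\<close>, so the first \<open>nu\<close> terms of the inner sum drop out.\<close>

lemma blk_mult_lower_tri:
  assumes T: "T \<in> carrier_mat n n" and L: "L \<in> carrier_mat n n" and lt: "lower_tri L" and "nu \<le> n"
  shows "blk (T * L) nu nu (n - nu) (n - nu) = blk T nu nu (n - nu) (n - nu) * blk L nu nu (n - nu) (n - nu)"
proof (rule eq_matI)
  let ?k = "n - nu"
  fix i j assume "i < dim_row (blk T nu nu ?k ?k * blk L nu nu ?k ?k)" "j < dim_col (blk T nu nu ?k ?k * blk L nu nu ?k ?k)"
  then have ij: "i < ?k" "j < ?k" by (auto simp: blk_def)
  have bc: "blk T nu nu ?k ?k \<in> carrier_mat ?k ?k" "blk L nu nu ?k ?k \<in> carrier_mat ?k ?k"
    by (auto simp: blk_def)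
  have "(T * L) $$ (i + nu,j + nu) = (\<Sum>l<nu + ?k. T $$ (i + nu,l) * L $$ (l,j + nu))"
    using mult_index_sum[OF T L, of "i + nu" "j + nu"] ij assms(4) by simp
  also have "\<dots> = (\<Sum>l<?k. T $$ (i + nu,nu + l) * L $$ (nu + l,j + nu))"
    unfolding sum_lessThan_add using lt L ij by (simp add: lower_tri_def)
  also have "\<dots> = (blk T nu nu ?k ?k * blk L nu nu ?k ?k) $$ (i,j)"
    unfolding mult_index_sum[OF bc ij] using ij by (intro sum.cong) (auto simp: blk_def add.commute)
  finally show "blk (T * L) nu nu ?k ?k $$ (i,j) = (blk T nu nu ?k ?k * blk L nu nu ?k ?k) $$ (i,j)"
    using ij by (simp add: blk_def)
qed (auto simp: blk_def)

section \<open>The punctured factor \<open>L_ap\<close> and the bound on the rows of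
  \<open>T\<close>\<close>

context
  fixes n nu :: nat and L :: "complex mat"
  assumes nu: "nu \<le> n" and L: "L \<in> carrier_mat n n" and lt: "lower_tri L"
    and diag: "\<And>i. i < n \<Longrightarrow> L $$ (i,i) \<noteq> 0"
begin

private abbreviation (input) "k \<equiv> n - nu"

private definition "S = blk L nu nu k k"

private definition "R = invC S"

text \<open>Diagonal entry \<open>i\<close> of \<open>R * adjC R\<close>; thus
  \<open>1 / sqrt (d i)\<close> is the corresponding entry of the scaling matrix
  \<open>Sigma\<close> in \<open>L_ap\<close>.\<close>

private definition "d i = (\<Sum>j<k. (cmod (R $$ (i,j)))\<^sup>2)"

text \<open>The matrix \<open>Wap\<close> from \<open>L_ap\<close> with the product
  \<open>Sigma * invC S\<close> multiplied out.\<close>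

private definition "V = four_block_mat (1\<^sub>m nu) (0\<^sub>m nu k) (0\<^sub>m k nu)
  (mat k k (\<lambda>(i,j). complex_of_real (1 / sqrt (d i)) * R $$ (i,j)))"

private lemma S: "S \<in> carrier_mat k k" "lower_tri S" "det S \<noteq> 0"
proof -
  show 1: "S \<in> carrier_mat k k" and 2: "lower_tri S"
    using lt L by (auto simp: S_def blk_def lower_tri_def)
  show "det S \<noteq> 0"
    unfolding det_lower_tri[OF 1 2] using diag by (auto simp: S_def blk_def)
qed

private lemmas R = invC[OF S(1,3), folded R_def]

text \<open>A zero row of \<open>R\<close> would give a zero row of \<open>R * S\<close>, which is
  the identity.\<close>

private lemma d_pos:
  assumes "i < k"
  shows "d i > 0"
proof -
  have "d i \<noteq> 0"
  proof
    assume "d i = 0"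
    then have "R $$ (i,j) = 0" if "j < k" for j
      using that by (simp add: d_def sum_nonneg_eq_0_iff)
    then have "(R * S) $$ (i,i) = 0"
      using mult_index_sum[OF R(1) S(1), of i i] assms by simp
    then show False
      using R(3) assms by simp
  qed
  moreover have "d i \<ge> 0" by (auto simp: d_def intro!: sum_nonneg)
  ultimately show ?thesis by simp
qed

private lemma V_carrier: "V \<in> carrier_mat n n"
  using nu by (auto simp: V_def)

private lemma L_ap_eq: "L_ap nu L = V * L"
proof -
  have "diag_inv_sqrt (diag_part (R * adjC R)) * R
      = mat k k (\<lambda>(i,j). complex_of_real (1 / sqrt (d i)) * R $$ (i,j))"
  proof (rule eq_matI)
    let ?D = "diag_inv_sqrt (diag_part (R * adjC R))"
    have D: "?D \<in> carrier_mat k k"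
      using R(1) by (auto simp: diag_inv_sqrt_def diag_part_def)
    have Dd: "?D $$ (i,l) = (if i = l then complex_of_real (1 / sqrt (d i)) else 0)" if "i < k" "l < k" for i l
    proof -
      have "(R * adjC R) $$ (i,i) = complex_of_real (d i)"
        using mult_index_sum[OF R(1) adjC_carrier[OF R(1)] that(1) that(1)] R(1) that
        by (simp add: d_def complex_norm_square[symmetric] del: index_mult_mat(1))
      then show ?thesis
        using that R(1) by (auto simp: diag_inv_sqrt_def diag_part_def simp del: index_mult_mat(1))
    qed
    fix i j assume "i < dim_row (mat k k (\<lambda>(i,j). complex_of_real (1 / sqrt (d i)) * R $$ (i,j)))"
      "j < dim_col (mat k k (\<lambda>(i,j). complex_of_real (1 / sqrt (d i)) * R $$ (i,j)))"
    then have ij: "i < k" "j < k" by auto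
    have "(?D * R) $$ (i,j) = (\<Sum>l<k. if l = i then complex_of_real (1 / sqrt (d i)) * R $$ (i,j) else 0)"
      unfolding mult_index_sum[OF D R(1) ij] using ij by (intro sum.cong) (auto simp: Dd)
    then show "(?D * R) $$ (i,j) = mat k k (\<lambda>(i,j). complex_of_real (1 / sqrt (d i)) * R $$ (i,j)) $$ (i,j)"
      using ij by simp
  qed (use R(1) in \<open>auto simp: diag_inv_sqrt_def diag_part_def\<close>)
  then show ?thesis
    using L by (simp add: L_ap_def Let_def V_def R_def S_def)
qed

text \<open>The scaling by \<open>1 / sqrt (d i)\<close> is what gives each row of \<open>V\<close>
  unit norm. The total \<open>n\<close> later cancels the additive constant \<open>n\<close> in
  \<open>I_LB_eq\<close>.\<close>

private lemma frob_V: "frob V = real n"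
proof -
  have "(\<Sum>j<n. (cmod (V $$ (i,j)))\<^sup>2) = 1" if "i < n" for i
  proof -
    have "(\<Sum>j<n. (cmod (V $$ (i,j)))\<^sup>2) = (\<Sum>j<nu. (cmod (V $$ (i,j)))\<^sup>2) + (\<Sum>j<k. (cmod (V $$ (i,nu + j)))\<^sup>2)"
      using sum_lessThan_add[of _ nu k] nu by simp
    also have "\<dots> = 1"
    proof (cases "i < nu")
      case True
      then have "(\<Sum>j<nu. (cmod (V $$ (i,j)))\<^sup>2) = (\<Sum>j<nu. if j = i then 1 else 0)"
        by (intro sum.cong) (auto simp: V_def)
      moreover have "(\<Sum>j<k. (cmod (V $$ (i,nu + j)))\<^sup>2) = 0"
        using True by (simp add: V_def)
      ultimately show ?thesis using True by simp
    next
      case False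
      define i' where "i' = i - nu"
      have i': "i = nu + i'" "i' < k" using False that by (auto simp: i'_def)
      have "(\<Sum>j<nu. (cmod (V $$ (i,j)))\<^sup>2) = 0"
        using i' by (simp add: V_def)
      moreover have "(\<Sum>j<k. (cmod (V $$ (i,nu + j)))\<^sup>2) = (\<Sum>j<k. (cmod (R $$ (i',j)))\<^sup>2 / d i')"
        using i' d_pos[OF i'(2)] by (intro sum.cong) (auto simp: V_def norm_mult power_mult_distrib norm_divide power_divide)
      ultimately show ?thesis
        using d_pos[OF i'(2)] by (simp flip: sum_divide_distrib d_def)
    qed
    finally show ?thesis .
  qed
  then show ?thesis using V_carrier by (simp add: frob_def)
qed

text \<open>The inverse \<open>R\<close> is lower triangular because \<open>R * S\<close> is the
  identity and the triangular factor \<open>S\<close> can be cancelled.\<close>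

private lemma lower_tri_V: "lower_tri V"
proof -
  have "lower_tri (R * S)"
    by (simp add: R(3) lower_tri_def)
  then have "lower_tri R"
    using diag by (intro lower_tri_mult_right_cancel[OF R(1) S(1,2)]) (auto simp: S_def blk_def)
  then show ?thesis
    using R(1) nu by (auto simp: lower_tri_def V_def)
qed

text \<open>The inverse inside \<open>V\<close> undoes the trailing block \<open>S\<close> of
  \<open>L\<close>, so only the real diagonal scaling remains. This is why \<open>L_ap\<close> is
  punctured.\<close>

private lemma blk_V_mult:
  assumes "i < k" "j < k"
  shows "(V * L) $$ (nu + i, nu + j) = (if i = j then complex_of_real (1 / sqrt (d i)) else 0)"
proof -
  have bV: "blk V nu nu k k \<in> carrier_mat k k" by (simp add: blk_def)
  have "(V * L) $$ (nu + i, nu + j) = blk (V * L) nu nu k k $$ (i,j)"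
    using assms by (simp add: blk_def add.commute)
  also have "\<dots> = (blk V nu nu k k * S) $$ (i,j)"
    unfolding S_def by (simp only: blk_mult_lower_tri[OF V_carrier L lt nu])
  also have "\<dots> = (\<Sum>l<k. complex_of_real (1 / sqrt (d i)) * (R $$ (i,l) * S $$ (l,j)))"
    unfolding mult_index_sum[OF bV S(1) assms] using assms
    by (intro sum.cong) (auto simp: blk_def V_def)
  also have "\<dots> = complex_of_real (1 / sqrt (d i)) * (R * S) $$ (i,j)"
    unfolding mult_index_sum[OF R(1) S(1) assms] sum_distrib_left ..
  finally show ?thesis
    using assms by (simp add: R(3))
qed

lemma punctured_L_ap: "punctured nu n (L_ap nu L)"
  unfolding punctured_iff[OF nu] L_ap_eq
proof (intro conjI allI impI)
  show "V * L \<in> carrier_mat n n" using V_carrier L by simp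
  show "lower_tri (V * L)" by (rule lower_tri_mult[OF V_carrier L lower_tri_V lt])
  fix i assume i: "i < n" "nu \<le> i"
  then show "(V * L) $$ (i,i) \<in> \<real>"
    using blk_V_mult[of "i - nu" "i - nu"] by (simp del: index_mult_mat(1))
  fix j assume j: "j < n" "nu \<le> j" "i \<noteq> j"
  then show "(V * L) $$ (i,j) = 0"
    using i blk_V_mult[of "i - nu" "j - nu"] by (auto simp del: index_mult_mat(1))
qed

lemma L_ap_diag_nonzero: "i < n \<Longrightarrow> L_ap nu L $$ (i,i) \<noteq> 0"
proof -
  assume i: "i < n"
  show ?thesis
  proof (cases "i < nu")
    case True
    then show ?thesis
      unfolding L_ap_eq diag_mult_lower_tri[OF V_carrier L lower_tri_V lt i] using i diag by (simp add: V_def)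
  next
    case False
    then have i': "i - nu < k" using i by simp
    then show ?thesis
      using blk_V_mult[OF i' i'] d_pos[OF i'] False
      unfolding L_ap_eq by (simp del: index_mult_mat(1))
  qed
qed

text \<open>Makes available outside the context the properties of the private matrix
  \<open>V\<close> that attainment of the optimum rests on.\<close>

lemma L_ap_factor:
  obtains V where "V \<in> carrier_mat n n" "L_ap nu L = V * L" "frob V = real n"
  using V_carrier L_ap_eq frob_V by blast

text \<open>For \<open>i < nu\<close>, cancellation makes \<open>T\<close> lower triangular, and
  \<open>L_ap\<close> has the diagonal entry of \<open>L\<close>; the quotient is the single term
  \<open>j = i\<close> of the sum. For later rows, the trailing block of \<open>T * L\<close> is
  diagonal, so the trailing part of row \<open>i\<close> of \<open>T\<close> is the diagonal entry
  of the product times a row of \<open>R\<close>. Its squared norm brings in the factor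
  \<open>d\<close>, which is the reciprocal square of the diagonal entry of
  \<open>L_ap\<close>.\<close>

lemma punctured_diag_le:
  assumes T: "T \<in> carrier_mat n n" and J: "punctured nu n (T * L)" and i: "i < n"
  shows "(cmod ((T * L) $$ (i,i)))\<^sup>2 / (cmod (L_ap nu L $$ (i,i)))\<^sup>2 \<le> (\<Sum>j<n. (cmod (T $$ (i,j)))\<^sup>2)"
proof (cases "i < nu")
  case True
  have "lower_tri (T * L)"
    using J by (simp add: punctured_iff[OF nu])
  then have ltT: "lower_tri T"
    using diag by (intro lower_tri_mult_right_cancel[OF T L lt])
  have "L_ap nu L $$ (i,i) = L $$ (i,i)"
    unfolding L_ap_eq diag_mult_lower_tri[OF V_carrier L lower_tri_V lt i] using True by (simp add: V_def)
  then have "(cmod ((T * L) $$ (i,i)))\<^sup>2 / (cmod (L_ap nu L $$ (i,i)))\<^sup>2 = (cmod (T $$ (i,i)))\<^sup>2"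
    unfolding diag_mult_lower_tri[OF T L ltT lt i] using diag[OF i] by (simp add: norm_mult power_mult_distrib)
  also have "\<dots> \<le> (\<Sum>j<n. (cmod (T $$ (i,j)))\<^sup>2)"
    using i by (intro member_le_sum) auto
  finally show ?thesis .
next
  case False
  define i' where "i' = i - nu"
  have i': "i = nu + i'" "i' < k" using False i by (auto simp: i'_def)
  let ?T = "blk T nu nu k k"
  let ?J = "blk (T * L) nu nu k k"
  have Tc: "?T \<in> carrier_mat k k" and Jc: "?J \<in> carrier_mat k k" by (auto simp: blk_def)
  have "?J = ?T * S"
    unfolding S_def by (rule blk_mult_lower_tri[OF T L lt nu])
  then have TJ: "?T = ?J * R"
    using assoc_mult_mat[OF Tc S(1) R(1)] Tc by (simp add: R(2))
  have row: "T $$ (i,nu + j) = (T * L) $$ (i,i) * R $$ (i',j)" if j: "j < k" for j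
  proof -
    have "T $$ (i,nu + j) = ?T $$ (i',j)"
      using i' j by (simp add: blk_def add.commute)
    also have "\<dots> = (\<Sum>l<k. ?J $$ (i',l) * R $$ (l,j))"
      by (subst TJ) (rule mult_index_sum[OF Jc R(1) i'(2) j])
    also have "\<dots> = (\<Sum>l<k. if l = i' then (T * L) $$ (i,i) * R $$ (i',j) else 0)"
      using J i' unfolding punctured_iff[OF nu]
      by (intro sum.cong) (auto simp: blk_def add.commute simp del: index_mult_mat(1))
    finally show ?thesis using i' by simp
  qed
  have "L_ap nu L $$ (i,i) = complex_of_real (1 / sqrt (d i'))"
    unfolding L_ap_eq i'(1) using blk_V_mult[OF i'(2) i'(2)] by simp
  then have "(cmod ((T * L) $$ (i,i)))\<^sup>2 / (cmod (L_ap nu L $$ (i,i)))\<^sup>2 = (cmod ((T * L) $$ (i,i)))\<^sup>2 * d i'"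
    using d_pos[OF i'(2)] by (simp add: power_divide norm_divide del: index_mult_mat(1))
  also have "\<dots> = (\<Sum>j<k. (cmod (T $$ (i,nu + j)))\<^sup>2)"
    by (simp add: row norm_mult power_mult_distrib d_def sum_distrib_left del: index_mult_mat(1))
  also have "\<dots> \<le> (\<Sum>j<nu + k. (cmod (T $$ (i,j)))\<^sup>2)"
    unfolding sum_lessThan_add by (auto intro!: sum_nonneg)
  finally show ?thesis using nu by simp
qed

end

section \<open>Attainment by the MMSE filter and the matching upper bound\<close>

theorem theorem3:
  fixes Nr Nt nu :: nat and H Qa La :: "complex mat" and Es N0 :: real
  assumes "2 \<le> Nt" and "Nt \<le> Nr"
    and "1 \<le> nu" and "nu \<le> Nt - 1"
    and "H \<in> carrier_mat Nr Nt"
    and "Es > 0" and "N0 > 0"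
    and "is_thin_QL (H_aug H Es N0) Qa La"
  shows "punctured nu Nt (L_ap nu La)
    \<and> I_LB_defined H Es N0 (adjC (W_MMSE H Es N0) * (adjC (L_ap nu La) * L_ap nu La))
                           (adjC (L_ap nu La) * L_ap nu La)
    \<and> I_LB H Es N0 (adjC (W_MMSE H Es N0) * (adjC (L_ap nu La) * L_ap nu La))
                   (adjC (L_ap nu La) * L_ap nu La)
        = real Nt * ln Es + ln (Re (det (adjC (L_ap nu La) * L_ap nu La)))
    \<and> (\<forall>F J. F \<in> carrier_mat Nr Nt \<longrightarrow> punctured nu Nt J \<longrightarrow>
          I_LB_defined H Es N0 F (adjC J * J) \<longrightarrow>
          I_LB H Es N0 F (adjC J * J)
            \<le> I_LB H Es N0 (adjC (W_MMSE H Es N0) * (adjC (L_ap nu La) * L_ap nu La))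
                             (adjC (L_ap nu La) * L_ap nu La))"
proof -
  have nu: "nu \<le> Nt" using assms by linarith
  note H = assms(5) and Es = assms(6) and N0 = assms(7)
  have Ac: "H_aug H Es N0 \<in> carrier_mat (Nr + Nt) Nt" by (rule H_aug_carrier[OF H])
  then have dims: "dim_row (H_aug H Es N0) = Nr + Nt" "dim_col (H_aug H Es N0) = Nt" by auto
  have Q: "Qa \<in> carrier_mat (Nr + Nt) Nt" and L: "La \<in> carrier_mat Nt Nt"
    and QQ: "adjC Qa * Qa = 1\<^sub>m Nt" and lt: "lower_tri La" and A: "H_aug H Es N0 = Qa * La"
    and pos: "\<forall>i < Nt. La $$ (i,i) \<in> \<real> \<and> Re (La $$ (i,i)) > 0"
    using assms(8) unfolding is_thin_QL_def dims by blast+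
  have diag: "La $$ (i,i) \<noteq> 0" if "i < Nt" for i
    using pos[rule_format, OF that] by force
  define P where "P = L_ap nu La"
  define W where "W = W_MMSE H Es N0"
  define F0 where "F0 = adjC W * (adjC P * P)"
  note ctx = nu L lt diag
  have pP: "punctured nu Nt P"
    unfolding P_def by (rule punctured_L_ap[OF ctx])
  then have P: "P \<in> carrier_mat Nt Nt" "lower_tri P"
    by (auto simp: punctured_iff[OF nu])
  have Pd: "P $$ (i,i) \<noteq> 0" if "i < Nt" for i
    unfolding P_def by (rule L_ap_diag_nonzero[OF ctx that])
  obtain V where V: "V \<in> carrier_mat Nt Nt" "P = V * La" "frob V = real Nt"
    unfolding P_def using L_ap_factor[OF ctx] by metis
  have W: "W \<in> carrier_mat Nt Nr" and UW: "aug_filter H Es N0 La (La * W) = adjC Qa"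
    unfolding W_def using aug_filter_W_MMSE[OF H Es N0 Q L QQ A lt diag] by blast+
  have PW: "P * W \<in> carrier_mat Nt Nr" using P W by auto
  have G: "adjC P * P \<in> carrier_mat Nt Nt" using P by auto
  have F0: "F0 \<in> carrier_mat Nr Nt"
    unfolding F0_def by (rule mult_carrier_mat[OF adjC_carrier[OF W] G])
  \<comment> \<open>For the candidate optimum, the matrix \<open>C\<close> of \<open>I_LB_eq\<close>
    is \<open>P * W\<close>.\<close>
  have "adjC F0 = (adjC P * P) * W"
    unfolding F0_def adjC_mult[OF adjC_carrier[OF W] G] adjC_mult[OF adjC_carrier[OF P(1)] P(1)] by simp
  then have CF0: "adjC P * (P * W) = adjC F0"
    using assoc_mult_mat[OF adjC_carrier[OF P(1)] P(1) W] by simp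
  \<comment> \<open>Since \<open>P = V * La\<close>, left multiplication of \<open>UW\<close> by
    \<open>V\<close> gives the filter of the candidate. Its squared norm is that of
    \<open>V\<close>, so the penalty is exactly \<open>Nt\<close>.\<close>
  have "aug_filter H Es N0 P (P * W) = V * adjC Qa"
    using mult_aug_filter[OF H Es N0 V(1) L, of "La * W"] assoc_mult_mat[OF V(1) L W] L W
    by (simp add: V(2) UW)
  then have fr: "Es * frob (P - P * W * H) + N0 * frob (P * W) = real Nt"
    using frob_aug_filter[OF H Es N0 P(1) PW] frob_mult_adjC[OF V(1) Q QQ] V(3) by simp
  note opt = I_LB_eq[OF P PW F0 CF0 H Es N0 Pd]
  have val: "I_LB H Es N0 F0 (adjC P * P) = real Nt * ln Es + (\<Sum>i<Nt. ln ((cmod (P $$ (i,i)))\<^sup>2))"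
    using opt(2) fr by simp
  \<comment> \<open>The determinant is the product of the squared moduli of the diagonal of
    \<open>P\<close>, which matches the sum of logarithms in \<open>val\<close>.\<close>
  have "det (adjC P * P) = complex_of_real ((cmod (det P))\<^sup>2)"
    unfolding det_mult[OF adjC_carrier[OF P(1)] P(1)] det_adjC[OF P]
    by (simp add: complex_norm_square[symmetric] mult.commute)
  then have "Re (det (adjC P * P)) = (cmod (det P))\<^sup>2"
    by (simp only: Re_complex_of_real)
  also have "\<dots> = (\<Prod>i<Nt. (cmod (P $$ (i,i)))\<^sup>2)"
    by (simp only: det_lower_tri[OF P] prod_norm[symmetric] prod_power_distrib)
  finally have "ln (Re (det (adjC P * P))) = (\<Sum>i<Nt. ln ((cmod (P $$ (i,i)))\<^sup>2))"
    by (simp only:) (rule ln_prod, use Pd in auto)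
  then have val': "I_LB H Es N0 F0 (adjC P * P) = real Nt * ln Es + ln (Re (det (adjC P * P)))"
    unfolding val by (simp only:)
  have "I_LB H Es N0 F (adjC J * J) \<le> I_LB H Es N0 F0 (adjC P * P)"
    if F: "F \<in> carrier_mat Nr Nt" and pJ: "punctured nu Nt J" and dJ: "I_LB_defined H Es N0 F (adjC J * J)" for F J
  proof -
    have J: "J \<in> carrier_mat Nt Nt" "lower_tri J"
      using pJ by (auto simp: punctured_iff[OF nu])
    have Jd: "J $$ (i,i) \<noteq> 0" if "i < Nt" for i
      by (rule I_LB_defined_imp_diag_nonzero[OF J F H Es dJ that])
    have "det J \<noteq> 0" using Jd by (simp add: det_lower_tri[OF J])
    note invJ = invC[OF J(1) this]
    \<comment> \<open>The solution of \<open>adjC J * C = adjC F\<close>, available for every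
      \<open>F\<close> because definedness of \<open>I_LB\<close> has forced \<open>J\<close> to be
      invertible.\<close>
    define C where "C = adjC (invC J) * adjC F"
    have C: "C \<in> carrier_mat Nt Nr"
      unfolding C_def using invJ F by auto
    have "adjC J * adjC (invC J) = 1\<^sub>m Nt"
      using adjC_mult[OF invJ(1) J(1)] invJ by simp
    then have CF: "adjC J * C = adjC F"
      unfolding C_def using assoc_mult_mat[OF adjC_carrier[OF J(1)] adjC_carrier[OF invJ(1)] adjC_carrier[OF F]] F
      by simp
    define U where "U = aug_filter H Es N0 J C"
    have U: "U \<in> carrier_mat Nt (Nr + Nt)"
      unfolding U_def by (rule aug_filter_carrier[OF H Es N0 J(1)])
    \<comment> \<open>The coordinates of the rows of \<open>U\<close> with respect to the
      orthonormal columns of \<open>Qa\<close>. Passing to them can only lower the penalty, and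
      \<open>J\<close> is recovered as \<open>T * La\<close>.\<close>
    define T where "T = U * Qa"
    have T: "T \<in> carrier_mat Nt Nt" using U Q by (simp add: T_def)
    have "T * La = U * (Qa * La)"
      unfolding T_def by (rule assoc_mult_mat[OF U Q L])
    also have "\<dots> = J"
      unfolding A[symmetric] U_def by (rule aug_filter_mult_H_aug[OF H Es N0 J(1) C])
    finally have TL: "T * La = J" .
    have "frob T \<le> Es * frob (J - C * H) + N0 * frob C"
      using frob_mult_le[OF U Q QQ] frob_aug_filter[OF H Es N0 J(1) C] by (simp only: T_def U_def)
    then have "I_LB H Es N0 F (adjC J * J)
        \<le> real Nt + real Nt * ln Es + (\<Sum>i<Nt. ln ((cmod (J $$ (i,i)))\<^sup>2)) - frob T"
      using I_LB_eq(2)[OF J C F CF H Es N0 Jd] by simp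
    also have "frob T = (\<Sum>i<Nt. \<Sum>j<Nt. (cmod (T $$ (i,j)))\<^sup>2)"
      using T by (simp add: frob_def)
    \<comment> \<open>The constant \<open>Nt\<close> is distributed as 1 per row, so that the
      remaining inequality can be proved for each row separately.\<close>
    also have "real Nt + real Nt * ln Es + (\<Sum>i<Nt. ln ((cmod (J $$ (i,i)))\<^sup>2)) - \<dots>
        = real Nt * ln Es + (\<Sum>i<Nt. 1 + ln ((cmod (J $$ (i,i)))\<^sup>2) - (\<Sum>j<Nt. (cmod (T $$ (i,j)))\<^sup>2))"
      by (simp add: sum.distrib sum_subtractf)
    also have "\<dots> \<le> real Nt * ln Es + (\<Sum>i<Nt. ln ((cmod (P $$ (i,i)))\<^sup>2))"
    proof (intro add_left_mono sum_mono)
      fix i assume "i \<in> {..<Nt}"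
      then have i: "i < Nt" by simp
      let ?x = "(cmod (J $$ (i,i)))\<^sup>2" and ?l = "(cmod (P $$ (i,i)))\<^sup>2"
      have pos: "?x > 0" "?l > 0" using Jd[OF i] Pd[OF i] by auto
      have "?x / ?l \<le> (\<Sum>j<Nt. (cmod (T $$ (i,j)))\<^sup>2)"
        using punctured_diag_le[OF ctx T _ i] pJ unfolding TL P_def by simp
      \<comment> \<open>The only freedom left in row \<open>i\<close> is the ratio of the two
        diagonal entries, and \<open>ln t - t\<close> is largest at \<open>t = 1\<close>, its value
        for the candidate.\<close>
      moreover have "ln (?x / ?l) \<le> ?x / ?l - 1"
        using pos by (intro ln_le_minus_one) simp
      moreover have "ln (?x / ?l) = ln ?x - ln ?l"
        using pos by (simp add: ln_div)
      ultimately show "1 + ln ?x - (\<Sum>j<Nt. (cmod (T $$ (i,j)))\<^sup>2) \<le> ln ?l"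
        by linarith
    qed
    finally show ?thesis unfolding val .
  qed
  with pP opt(1) val' show ?thesis
    unfolding F0_def P_def W_def by (intro conjI allI impI)
qed

end
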